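(* Every properly edge-coloured complete directed graph $\overleftrightarrow{K_n}$ contains a rainbow path forest of length $n-O(n^{2/3})$ and a rainbow (directed) cycle of length $n-O(n^{4/5})$. That is, there are absolute constants $C>0$ and $n_0$ such that for every $n\ge n_0$ and every proper edge-colouring of $\overleftrightarrow{K_n}$, there is a rainbow path forest in $\overleftrightarrow{K_n}$ with at least $n-Cn^{2/3}$ edges, and there is a rainbow directed cycle in $\overleftrightarrow{K_n}$ of length at least $n-Cn^{4/5}$.
   Context: $\overleftrightarrow{K_n}$ is the complete directed graph on $n$ vertices: for any two distinct vertices $u,v$ both directed edges $uv$ and $vu$ are present (no loops). An edge-colouring of a digraph is proper if no two distinct edges with a common start point have the same colour and no two distinct edges with a common end point have the same colour (edges $uv$ and $vw$ may share a colour). A subgraph is rainbow if all its edges have pairwise distinct colours. A path forest is a collection of pairwise vertex-disjoint directed paths (single-vertex paths allowed); equivalently a subgraph containing no directed cycle in which every vertex has in-degree and out-degree at most 1. Its length is its total number of edges. The length of a directed cycle is its number of edges (equivalently vertices). *)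

theory Defs
  imports Complex_Main "Graph_Theory.Graph_Theory"
begin

text \<open>
  The complete directed graph is \<^const>\<open>complete_digraph\<close>: finitely many vertices,
  no loops, no parallel arcs, and an arc for every ordered pair of distinct vertices.
  Directed cycles are those of \<^const>\<open>pre_digraph.cycle\<close>, given by their nonempty
  list of arcs; the number of arcs is the length of that list.

  Vertices, arcs and colours are of arbitrary type. Only finitely many of each
  occur for a given digraph, so the instance with all three types infinite (e.g. \<^typ>\<open>nat\<close>)
  yields constants that serve for every choice of types.
\<close>

definition proper_arc_colouring :: "('a, 'b) pre_digraph \<Rightarrow> ('b \<Rightarrow> 'c) \<Rightarrow> bool" where
  "proper_arc_colouring G c \<longleftrightarrow>
     (\<forall>e \<in> arcs G. \<forall>f \<in> arcs G. e \<noteq> f \<and> tail G e = tail G f \<longrightarrow> c e \<noteq> c f) \<and>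
     (\<forall>e \<in> arcs G. \<forall>f \<in> arcs G. e \<noteq> f \<and> head G e = head G f \<longrightarrow> c e \<noteq> c f)"

definition rainbow :: "('b \<Rightarrow> 'c) \<Rightarrow> 'b set \<Rightarrow> bool" where
  "rainbow c A \<longleftrightarrow> inj_on c A"

text \<open>
  A path is a pair of its start vertex and its list of arcs; the pair with the
  empty list is the single-vertex path.
\<close>

definition path_forest :: "('a, 'b) pre_digraph \<Rightarrow> ('a \<times> 'b awalk) set \<Rightarrow> bool" where
  "path_forest G F \<longleftrightarrow>
     (\<forall>(u, p) \<in> F. \<exists>v. pre_digraph.apath G u p v) \<and>
     pairwise (\<lambda>(u, p) (w, q).
       disjnt (set (pre_digraph.awalk_verts G u p)) (set (pre_digraph.awalk_verts G w q))) F"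

definition forest_arcs :: "('a \<times> 'b awalk) set \<Rightarrow> 'b set" where
  "forest_arcs F = (\<Union>(u, p) \<in> F. set p)"

definition forest_length :: "('a \<times> 'b awalk) set \<Rightarrow> nat" where
  "forest_length F = card (forest_arcs F)"

end

theory Submission
  imports Defs "HOL-Library.FuncSet" "HOL-Library.Disjoint_Sets" "HOL-Real_Asymp.Real_Asymp"
begin

text \<open>
  Both halves rest on one statement about path forests whose paths start in a prescribed set \<open>S\<close> of
  \<open>r\<close> vertices, \<open>long_rainbow_forest\<close>. Let \<open>F\<close> be such a rainbow forest with as many edges as
  possible. Choose \<open>m\<close> of its \<open>r\<close> paths, with at most \<open>m n / r\<close> vertices in total; let \<open>U\<close> be the
  set of these vertices and let \<open>t\<close> run through the ends of the chosen paths. If \<open>v\<close> outside \<open>U\<close> is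
  the head of an edge \<open>u v\<close> of \<open>F\<close>, then trading \<open>u v\<close> for \<open>t v\<close> gives a rooted forest of the same
  size: the chosen path of \<open>t\<close> is prepended to the part of the other path from \<open>v\<close> on, and no cycle
  arises because \<open>v\<close> is not on the chosen path. The trade needs the colour of \<open>t v\<close> and releases
  the colour of \<open>u v\<close>, which then is available to edges from the next end. By maximality, an edge
  with an available colour from \<open>t\<close> to a vertex outside \<open>U\<close> and \<open>S\<close> always leads to the head of an
  edge of \<open>F\<close>. Since the edges at \<open>t\<close> have distinct colours, counting shows that each of the \<open>m\<close>
  ends releases at least \<open>N - r - |U| - |F|\<close> further edges, where \<open>N\<close> is the minimum out-degree. As at most
  \<open>n\<close> edges can be released, \<open>|F| \<ge> N - r - m n / r - n / m\<close>. With \<open>r\<close> about \<open>n\<close> to the \<open>2/3\<close> and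
  \<open>m\<close> about \<open>n\<close> to the \<open>1/3\<close> this is the statement on path forests.

  For the cycle, reserve a random set \<open>W\<close> of vertices and a random set \<open>R\<close> of colours, each element
  with probability \<open>1 / x\<close> where \<open>x\<close> is the fifth root of \<open>n\<close>. This costs \<open>O(x ^ 4)\<close> vertices, and the
  out-degrees drop by \<open>O(x ^ 4)\<close>. Outside the reservoir, the forest statement with \<open>r\<close> a small
  multiple of \<open>x ^ 2\<close> and \<open>m\<close> about \<open>x\<close> gives at most \<open>r\<close> paths with \<open>n - O(x ^ 4)\<close> edges. For
  vertices \<open>x'\<close> and \<open>y\<close> there are typically of order \<open>x ^ 2\<close> vertices \<open>w\<close> in \<open>W\<close> such that the path
  \<open>x' w y\<close> is rainbow with both colours in \<open>R\<close> (\<open>exists_reservoir\<close>). Linking two paths uses one such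
  \<open>w\<close> and two colours, each of which spoils a bounded number of connectors for later links. So the
  paths can be linked greedily, in cyclic order (\<open>exists_linked_cycle\<close>). The colouring may be such
  that \<open>x' w\<close> and \<open>w y\<close> have the same colour for most \<open>w\<close>, but for fixed \<open>y\<close> this cannot happen for
  two vertices \<open>x'\<close> at once; so it suffices to drop, if necessary, the last vertex of a path before
  linking it to the next one.
\<close>

section \<open>Long rainbow forests with prescribed roots\<close>

text \<open>
  Edge sets are sets of ordered pairs. A linear edge set is a vertex-disjoint union of directed
  paths. Swapping one edge for another is a simple set operation in this form, and the explicit
  paths are recovered by \<open>rooted_forest_paths\<close> only where they are needed.
\<close>
definition linear_digraph :: "('a \<times> 'a) set \<Rightarrow> bool" where
  "linear_digraph F \<longleftrightarrow> finite F \<and> single_valued F \<and> single_valued (F\<inverse>) \<and> acyclic F"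

text \<open>
  Every path with an edge starts in \<open>S\<close>, so there are exactly \<open>card S\<close> paths if the
  vertices of \<open>S\<close> that are isolated are counted as paths of length zero. Fixing \<open>S\<close> in
  advance is what bounds the number of paths: the swaps below preserve the set of heads of edges,
  hence also the roots.
\<close>
definition rooted_forest :: "'a set \<Rightarrow> ('a \<times> 'a) set \<Rightarrow> bool" where
  "rooted_forest S F \<longleftrightarrow> linear_digraph F \<and> S \<inter> Range F = {} \<and> Domain F \<subseteq> S \<union> Range F"

definition path_system :: "'a set \<Rightarrow> ('a \<Rightarrow> 'a list) \<Rightarrow> bool" where
  "path_system S P \<longleftrightarrow>
     (\<forall>s\<in>S. P s \<noteq> [] \<and> hd (P s) = s \<and> distinct (P s)) \<and>
     (\<forall>s\<in>S. \<forall>s'\<in>S. s \<noteq> s' \<longrightarrow> set (P s) \<inter> set (P s') = {})"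

lemma linear_subset: "linear_digraph F \<Longrightarrow> F' \<subseteq> F \<Longrightarrow> linear_digraph F'"
  unfolding linear_digraph_def
  by (meson acyclic_subset converse_mono finite_subset single_valued_subset)

lemma linear_insert:
  assumes "linear_digraph F" "a \<notin> Domain F" "b \<notin> Range F" "(b, a) \<notin> F\<^sup>*"
  shows "linear_digraph (insert (a, b) F)"
  using assms unfolding linear_digraph_def by (auto simp: single_valued_def)

lemma linear_card_Range:
  assumes "linear_digraph F" shows "card (Range F) = card F"
proof -
  have "inj_on snd F"
    using assms by (auto simp: linear_digraph_def single_valued_def inj_on_def)
  then show ?thesis by (simp add: Range_snd card_image)
qed

lemma not_last_imp_tail:
  "x \<in> set p \<Longrightarrow> x \<noteq> last p \<Longrightarrow> x \<in> Domain (set (vwalk_arcs p))"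
  by (induction p rule: vwalk_arcs.induct) auto

text \<open>
  Induction on the edge set: by acyclicity some edge leads to a sink; remove it, and append the sink
  to the path that ends in its predecessor.
\<close>
lemma rooted_forest_paths:
  assumes "rooted_forest S F"
  obtains P where "path_system S P" "(\<Union>s\<in>S. set (vwalk_arcs (P s))) = F"
    "(\<Union>s\<in>S. set (P s)) = S \<union> Range F"
proof -
  have "finite F" using assms by (simp add: rooted_forest_def linear_digraph_def)
  then have "\<exists>P. path_system S P \<and> (\<Union>s\<in>S. set (vwalk_arcs (P s))) = F \<and>
    (\<Union>s\<in>S. set (P s)) = S \<union> Range F"
    using assms
  proof (induction F rule: finite_psubset_induct)
    case (psubset F)
    show ?case
    proof (cases "F = {}")
      case True
      then show ?thesis
        by (intro exI[of _ "\<lambda>s. [s]"]) (auto simp: path_system_def)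
    next
      case False
      have lin: "linear_digraph F" and SR: "S \<inter> Range F = {}" and D: "Domain F \<subseteq> S \<union> Range F"
        using psubset.prems by (auto simp: rooted_forest_def)
      have "wf (F\<inverse>)"
        using lin by (simp add: linear_digraph_def finite_acyclic_wf_converse)
      moreover obtain a b where "(a, b) \<in> F" using False by auto
      ultimately obtain v where v: "v \<in> Range F" "\<And>y. (y, v) \<in> F\<inverse> \<Longrightarrow> y \<notin> Range F"
        by (metis Range.intros wfE_min)
      then have vD: "v \<notin> Domain F" by blast
      obtain u where uv: "(u, v) \<in> F" using v by blast
      let ?F = "F - {(u, v)}"
      have nR: "v \<notin> Range ?F" and nD: "u \<notin> Domain ?F"
        using lin uv by (auto simp: linear_digraph_def single_valued_def)
      have "rooted_forest S ?F"
        unfolding rooted_forest_def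
      proof (intro conjI)
        show "linear_digraph ?F" using lin by (rule linear_subset) auto
        show "S \<inter> Range ?F = {}" using SR by auto
        show "Domain ?F \<subseteq> S \<union> Range ?F" using D vD by blast
      qed
      with psubset.IH[of ?F] uv obtain P where P: "path_system S P"
        "(\<Union>s\<in>S. set (vwalk_arcs (P s))) = ?F" "(\<Union>s\<in>S. set (P s)) = S \<union> Range ?F"
        by blast
      have "u \<in> S \<union> Range ?F" using D uv vD by blast
      then obtain s where s: "s \<in> S" "u \<in> set (P s)" using P(3) by blast
      have last: "last (P s) = u"
        using not_last_imp_tail[OF s(2)] nD P(2) s(1) by blast
      have vnew: "v \<notin> set (P s')" if "s' \<in> S" for s'
        using P(3) that nR SR v(1) by blast
      have Ps: "P s \<noteq> []" using s by auto
      let ?P = "P(s := P s @ [v])"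
      have "path_system S ?P"
        using P(1) vnew s(1) Ps unfolding path_system_def by (auto simp: fun_upd_def)
      moreover have "(\<Union>s\<in>S. set (vwalk_arcs (?P s))) = insert (u, v) (\<Union>s\<in>S. set (vwalk_arcs (P s)))"
        using s(1) last set_vwalk_arcs_snoc[OF Ps, of v] by (auto split: if_splits)
      moreover have "(\<Union>s\<in>S. set (?P s)) = insert v (\<Union>s\<in>S. set (P s))"
        using s(1) by (auto split: if_splits)
      ultimately show ?thesis
        using uv P(2,3) by (intro exI[of _ ?P]) (auto simp del: fun_upd_apply)
    qed
  qed
  then show thesis using that by blast
qed

text \<open>
  Discarding the heaviest element lowers the average weight; this is repeated until \<open>m\<close> elements
  are left.
\<close>
lemma light_subset:
  fixes f :: "'a \<Rightarrow> nat"
  assumes "finite S" "m \<le> card S"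
  shows "\<exists>T\<subseteq>S. card T = m \<and> card S * sum f T \<le> m * sum f S"
  using assms
proof (induction "card S - m" arbitrary: S)
  case 0
  then show ?case by (intro exI[of _ S]) auto
next
  case (Suc d)
  then have "S \<noteq> {}" by auto
  then have "Max (f ` S) \<in> f ` S" using Suc.prems(1) by simp
  then obtain a where "a \<in> S" "f a = Max (f ` S)" by auto
  then have a: "a \<in> S" "\<And>x. x \<in> S \<Longrightarrow> f x \<le> f a"
    using Suc.prems(1) by auto
  have cS: "card S = Suc (card (S - {a}))"
    using a(1) Suc.prems(1) by (meson card.remove)
  then have d: "d = card (S - {a}) - m" "finite (S - {a})" "m \<le> card (S - {a})"
    using Suc.hyps(2) Suc.prems by auto
  obtain T where T: "T \<subseteq> S - {a}" "card T = m"
    "card (S - {a}) * sum f T \<le> m * sum f (S - {a})"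
    using Suc.hyps(1)[OF d] by blast
  have "sum f T \<le> m * f a"
    using sum_bounded_above[of T f "f a"] T(1,2) a(2) by auto
  moreover have "sum f S = f a + sum f (S - {a})"
    using a(1) Suc.prems(1) by (simp add: sum.remove)
  ultimately have "card S * sum f T \<le> m * sum f S"
    using T(3) cS by (simp add: algebra_simps)
  then show ?case using T by blast
qed

text \<open>
  The setting of the exchange argument. \<open>F\<close> is a rainbow rooted forest inside the set \<open>H\<close> of
  admissible edges, \<open>U\<close> is the vertex set of \<open>m\<close> of its paths, and \<open>t 0, \<dots>, t (m - 1)\<close> are the
  ends of these paths. No edge of \<open>F\<close> enters \<open>U\<close> from outside, and the edges added later lead from
  some \<open>t i\<close> to a vertex outside \<open>U\<close>. Hence no vertex outside \<open>U\<close> can ever reach an end \<open>t i\<close>,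
  and no exchange closes a cycle.
\<close>
locale switching =
  fixes S :: "'a set" and H F :: "('a \<times> 'a) set" and c :: "'a \<times> 'a \<Rightarrow> 'c"
    and U :: "'a set" and t :: "nat \<Rightarrow> 'a" and m :: nat
  assumes forest: "rooted_forest S F" and FH: "F \<subseteq> H" and inj: "inj_on c F"
    and U_closed: "\<And>x y. (x, y) \<in> F \<Longrightarrow> y \<in> U \<Longrightarrow> x \<in> U"
    and t: "\<And>i. i < m \<Longrightarrow> t i \<in> U \<and> t i \<notin> Domain F \<and> t i \<in> S \<union> Range F"
    and t_inj: "inj_on t {..<m}"
begin

text \<open>
  The edges whose colour can be released with the help of the ends \<open>t i\<close>, \<open>i < j\<close>. The edge
  \<open>(u, v)\<close> can be traded for \<open>(t j, v)\<close> as soon as the colour of the latter is unused by \<open>F\<close> or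
  was released before, that is, unless it occurs on \<open>F - freed j\<close>.
\<close>
primrec freed :: "nat \<Rightarrow> ('a \<times> 'a) set" where
  "freed 0 = {}"
| "freed (Suc j) = freed j \<union>
     {(u, v) \<in> F. v \<notin> U \<and> (t j, v) \<in> H \<and> c (t j, v) \<notin> c ` (F - freed j)}"

text \<open>
  A forest as long as \<open>F\<close> that avoids the colour \<open>k\<close> and differs from \<open>F\<close> only by trades at the
  first \<open>j\<close> ends; in particular \<open>t j\<close> is still the end of its path.
\<close>
definition variant :: "nat \<Rightarrow> 'c \<Rightarrow> ('a \<times> 'a) set \<Rightarrow> bool" where
  "variant j k F' \<longleftrightarrow> rooted_forest S F' \<and> F' \<subseteq> H \<and> inj_on c F' \<and> card F' = card F \<and>
     k \<notin> c ` F' \<and> F - freed j \<subseteq> F' \<and> F' - F \<subseteq> t ` {..<j} \<times> (- U) \<and> Range F' = Range F"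

lemma freed_subset: "freed j \<subseteq> F"
  by (induction j) auto

lemma variant_end_unreachable:
  assumes "variant j k F'" "i < m" "v \<notin> U" "F'' \<subseteq> F'"
  shows "(v, t i) \<notin> F''\<^sup>*"
proof
  assume "(v, t i) \<in> F''\<^sup>*"
  then have "(v, t i) \<in> F'\<^sup>*" using assms(4) by (meson rtrancl_mono subsetD)
  then have "v \<in> U"
  proof (induction rule: converse_rtrancl_induct)
    case base
    then show ?case using t assms(2) by blast
  next
    case (step y z)
    have "F' - F \<subseteq> t ` {..<j} \<times> (- U)" using assms(1) by (simp add: variant_def)
    then have "(y, z) \<in> F" using step by blast
    then show ?case using U_closed step.IH by blast
  qed
  then show False using assms(3) by blast
qed

lemma variant_end_free:
  assumes "variant j k F'" "j < m" shows "t j \<notin> Domain F'"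
proof
  assume "t j \<in> Domain F'"
  then obtain y where "(t j, y) \<in> F'" by blast
  moreover have "(t j, y) \<notin> F" using t[OF assms(2)] by blast
  ultimately obtain i where "i < j" "t i = t j"
    using assms(1) by (auto simp: variant_def)
  then show False using t_inj assms(2) by (metis lessThan_iff inj_onD less_trans less_irrefl)
qed

text \<open>
  Either \<open>k\<close> is available without the end \<open>t j\<close>, or it is the colour of an edge \<open>(u, v)\<close> that was
  released by \<open>t j\<close>. In the second case a variant that avoids the colour of \<open>(t j, v)\<close> exists by
  induction. It still contains \<open>(u, v)\<close>, because only edges released earlier have been removed, and
  trading \<open>(u, v)\<close> for \<open>(t j, v)\<close> gives the result.
\<close>
lemma exists_variant:
  "j \<le> m \<Longrightarrow> k \<notin> c ` (F - freed j) \<Longrightarrow> \<exists>F'. variant j k F'"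
proof (induction j arbitrary: k)
  case 0
  then have "variant 0 k F" using forest FH inj by (simp add: variant_def)
  then show ?case ..
next
  case (Suc j)
  show ?case
  proof (cases "k \<in> c ` (F - freed j)")
    case False
    then obtain F' where "variant j k F'" using Suc.IH[OF _ False] Suc.prems(1) by auto
    then have "variant (Suc j) k F'" by (auto simp: variant_def less_Suc_eq)
    then show ?thesis ..
  next
    case True
    then obtain u v where uv: "(u, v) \<in> F - freed j" "k = c (u, v)" by auto
    with Suc.prems(2) have uv': "(u, v) \<in> freed (Suc j)" by blast
    with uv have vU: "v \<notin> U" and tvH: "(t j, v) \<in> H"
      and tvc: "c (t j, v) \<notin> c ` (F - freed j)" by auto
    obtain F' where F': "variant j (c (t j, v)) F'" using Suc.IH[OF _ tvc] Suc.prems by auto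
    have jm: "j < m" using Suc.prems by simp
    have uvF': "(u, v) \<in> F'" using F' uv by (auto simp: variant_def)
    have rf: "rooted_forest S F'" using F' by (simp add: variant_def)
    have lin: "linear_digraph F'" and SR: "S \<inter> Range F' = {}" and D: "Domain F' \<subseteq> S \<union> Range F'"
      using rf unfolding rooted_forest_def by blast+
    let ?G = "F' - {(u, v)}"
    let ?F = "insert (t j, v) ?G"
    have vR: "v \<notin> Range ?G" using lin uvF' by (auto simp: linear_digraph_def single_valued_def)
    have Rng: "Range ?F = Range F'" using uvF' by auto
    have tj: "t j \<notin> Domain F'" using variant_end_free[OF F' jm] .
    have "linear_digraph ?F"
    proof (rule linear_insert)
      show "linear_digraph ?G" using lin by (rule linear_subset) auto
      show "(v, t j) \<notin> ?G\<^sup>*" using variant_end_unreachable[OF F' jm vU] by blast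
    qed (use tj vR in auto)
    moreover have "Domain ?F \<subseteq> S \<union> Range ?F"
      unfolding Rng using D t[OF jm] F' by (auto simp: variant_def)
    ultimately have "rooted_forest S ?F"
      using SR unfolding rooted_forest_def Rng by blast
    moreover have "inj_on c ?F"
      using F' unfolding variant_def by (auto intro: inj_on_diff)
    moreover have "k \<notin> c ` ?F"
    proof -
      have "inj_on c F'" "c (t j, v) \<notin> c ` F'" using F' by (simp_all add: variant_def)
      then have "c ` ?G = c ` F' - {k}"
        using inj_on_image_set_diff[of c F' F' "{(u, v)}"] uvF' by (auto simp: uv(2))
      moreover have "c (t j, v) \<noteq> k"
        using \<open>c (t j, v) \<notin> c ` F'\<close> uvF' uv(2) by (metis imageI)
      ultimately show ?thesis by simp
    qed
    moreover have "card ?F = card F"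
    proof -
      have "finite F'" using lin by (simp add: linear_digraph_def)
      then have "card ?F = Suc (card ?G)" using tj by (subst card_insert_disjoint) auto
      also have "\<dots> = card F'" using \<open>finite F'\<close> uvF' by (metis card.remove)
      finally show ?thesis using F' by (simp add: variant_def)
    qed
    moreover have "F - freed (Suc j) \<subseteq> ?F"
      using uv' F' by (auto simp: variant_def)
    moreover have "?F - F \<subseteq> t ` {..<Suc j} \<times> (- U)"
      using F' vU by (auto simp: variant_def less_Suc_eq)
    moreover have "Range ?F = Range F" using F' Rng by (simp add: variant_def)
    moreover have "?F \<subseteq> H" using F' tvH by (auto simp: variant_def)
    ultimately have "variant (Suc j) k ?F" by (simp add: variant_def)
    then show ?thesis ..
  qed
qed

text \<open>
  Consider the edges from \<open>t j\<close> to vertices outside \<open>U\<close> and \<open>S\<close>. Their colours are distinct, so at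
  most \<open>card F - card (freed j)\<close> of them have a colour that is not available. Every other one must
  lead to the head of an edge of \<open>F\<close>: otherwise it could be added to a variant that avoids its
  colour, against the maximality of \<open>F\<close>. The edge of \<open>F\<close> that enters this head is then released.
\<close>
lemma freed_grows:
  assumes maxF: "\<And>F'. rooted_forest S F' \<Longrightarrow> F' \<subseteq> H \<Longrightarrow> inj_on c F' \<Longrightarrow> card F' \<le> card F"
    and jm: "j < m" and fin: "finite S" "finite U" "finite H"
    and deg: "N \<le> card (H `` {t j})" and injt: "inj_on (\<lambda>v. c (t j, v)) (H `` {t j})"
  shows "N + card (freed j) \<le> card (freed (Suc j)) + card F + card U + card S"
proof -
  have finF: "finite F" using forest by (simp add: rooted_forest_def linear_digraph_def)
  let ?A = "H `` {t j} - U - S"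
  let ?B = "{v \<in> ?A. c (t j, v) \<in> c ` (F - freed j)}"
  have finA: "finite (H `` {t j})" using fin(3) by (simp add: finite_Image)
  have "N \<le> card ?A + card U + card S"
    using deg diff_card_le_card_Diff[OF fin(2), of "H `` {t j}"]
      diff_card_le_card_Diff[OF fin(1), of "H `` {t j} - U"] by linarith
  moreover have "card ?B \<le> card F - card (freed j)"
  proof -
    have "card ?B \<le> card (F - freed j)"
    proof (rule card_le_if_inj_on_rel[where r = "\<lambda>v e. c (t j, v) = c e"])
      show "finite (F - freed j)" using finF by simp
      show "\<exists>e. e \<in> F - freed j \<and> c (t j, v) = c e" if "v \<in> ?B" for v using that by auto
      show "v = w" if "v \<in> ?B" "w \<in> ?B" "e \<in> F - freed j" "c (t j, v) = c e" "c (t j, w) = c e" for v w e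
        by (rule inj_onD[OF injt]) (use that in auto)
    qed
    then show ?thesis
      using freed_subset[of j] finF by (simp add: card_Diff_subset finite_subset)
  qed
  moreover have "card (?A - ?B) \<le> card (freed (Suc j))"
  proof -
    have "?A - ?B \<subseteq> snd ` freed (Suc j)"
    proof
      fix v assume v: "v \<in> ?A - ?B"
      then have v': "(t j, v) \<in> H" "v \<notin> U" "v \<notin> S" "c (t j, v) \<notin> c ` (F - freed j)" by auto
      have "v \<in> Range F"
      proof (rule ccontr)
        assume nR: "v \<notin> Range F"
        obtain F' where F': "variant j (c (t j, v)) F'"
          using exists_variant[OF _ v'(4)] jm by auto
        have rf: "rooted_forest S F'" using F' by (simp add: variant_def)
        have R: "Range F' = Range F" using F' by (simp add: variant_def)
        have lin: "linear_digraph F'" and SR: "S \<inter> Range F' = {}" and D: "Domain F' \<subseteq> S \<union> Range F'"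
          using rf unfolding rooted_forest_def by blast+
        let ?F = "insert (t j, v) F'"
        have "linear_digraph ?F"
          using linear_insert[OF lin] variant_end_free[OF F' jm] nR R
            variant_end_unreachable[OF F' jm v'(2) subset_refl] by auto
        then have "rooted_forest S ?F"
          using SR D v'(3) t[OF jm] R by (auto simp: rooted_forest_def)
        moreover have "?F \<subseteq> H" "inj_on c ?F"
          using F' v'(1) by (auto simp: variant_def)
        ultimately have "card ?F \<le> card F" by (rule maxF)
        moreover have "finite F'" using lin by (simp add: linear_digraph_def)
        then have "card ?F = Suc (card F')"
          using variant_end_free[OF F' jm] by (subst card_insert_disjoint) auto
        ultimately show False using F' by (simp add: variant_def)
      qed
      then obtain u where "(u, v) \<in> F" by blast
      then have "(u, v) \<in> freed (Suc j)" using v' by auto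
      then show "v \<in> snd ` freed (Suc j)" by force
    qed
    then show ?thesis
      using finF freed_subset[of "Suc j"] by (meson finite_subset surj_card_le)
  qed
  moreover have "card ?A = card ?B + card (?A - ?B)"
    using finA by (metis (no_types, lifting) card_Diff_subset card_mono finite_Diff finite_subset le_add_diff_inverse mem_Collect_eq subsetI)
  moreover have "card (freed j) \<le> card F" using finF freed_subset by (simp add: card_mono)
  ultimately show ?thesis by linarith
qed

end

text \<open>
  Apply the exchange argument to a forest with the maximal number of edges and to \<open>m\<close> of its
  \<open>card S\<close> paths that have at most \<open>m * card V / card S\<close> vertices in total. The number of
  released edges grows in each of \<open>m\<close> rounds by at least
  \<open>N - card S - card U - card F\<close>, but it never exceeds \<open>card V\<close>.
\<close>
theorem long_rainbow_forest:
  fixes c :: "'a \<times> 'a \<Rightarrow> 'c" and N m :: nat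
  assumes fin: "finite V" and HV: "H \<subseteq> V \<times> V" and SV: "S \<subseteq> V"
    and deg: "\<And>x. x \<in> V \<Longrightarrow> N \<le> card (H `` {x})"
    and proper: "\<And>x. x \<in> V \<Longrightarrow> inj_on (\<lambda>v. c (x, v)) (H `` {x})"
    and m: "0 < m" "m \<le> card S"
  obtains F where "rooted_forest S F" "F \<subseteq> H" "inj_on c F"
    "real (card F) \<ge> real N - card S - real m * card V / card S - card V / real m"
proof -
  let ?ok = "\<lambda>F. rooted_forest S F \<and> F \<subseteq> H \<and> inj_on c F"
  have finS: "finite S" and finH: "finite H"
    using fin HV SV finite_subset by blast+
  have "?ok {}" by (auto simp: rooted_forest_def linear_digraph_def single_valued_def acyclic_def)
  moreover have "\<forall>F. ?ok F \<longrightarrow> card F < Suc (card H)"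
    using finH card_mono by (auto simp: less_Suc_eq_le)
  ultimately obtain F where F: "?ok F" and maxF: "\<And>F'. ?ok F' \<Longrightarrow> card F' \<le> card F"
    using ex_has_greatest_nat[of ?ok "{}" card "Suc (card H)"] by blast
  obtain P where P: "path_system S P" "(\<Union>s\<in>S. set (vwalk_arcs (P s))) = F"
    "(\<Union>s\<in>S. set (P s)) = S \<union> Range F"
    using F rooted_forest_paths by metis
  have Pne: "P s \<noteq> []" "distinct (P s)" if "s \<in> S" for s
    using P(1) that by (auto simp: path_system_def)
  have Pdisj: "s = s'" if "s \<in> S" "s' \<in> S" "x \<in> set (P s)" "x \<in> set (P s')" for s s' x
    using P(1) that unfolding path_system_def by blast
  have PV: "(\<Union>s\<in>S. set (P s)) \<subseteq> V" using P(3) F HV SV by auto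
  have "sum (\<lambda>s. card (set (P s))) S = card (\<Union>s\<in>S. set (P s))"
    by (rule card_UN_disjoint[symmetric]) (use finS Pdisj in auto)
  also have "\<dots> \<le> card V" using PV fin by (rule card_mono[rotated])
  finally have total: "sum (\<lambda>s. card (set (P s))) S \<le> card V" .
  obtain T where T: "T \<subseteq> S" "card T = m"
    "card S * sum (\<lambda>s. card (set (P s))) T \<le> m * sum (\<lambda>s. card (set (P s))) S"
    using light_subset[OF finS m(2)] by blast
  have finT: "finite T" using T(1) finS finite_subset by blast
  define U where "U = (\<Union>s\<in>T. set (P s))"
  have finU: "finite U" using finT by (simp add: U_def)
  have "card U \<le> sum (\<lambda>s. card (set (P s))) T"
    unfolding U_def using finT by (rule card_UN_le)
  then have "card S * card U \<le> m * card V"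
    using T(3) total by (meson le_trans mult_le_mono2)
  then have U_le: "real (card U) \<le> real m * card V / card S"
    using m by (simp add: field_simps flip: of_nat_mult)
  obtain e where e: "bij_betw e {..<m} T"
    using ex_bij_betw_nat_finite[OF finT] T(2) by (metis atLeast0LessThan)
  define t where "t i = last (P (e i))" for i
  have eT: "e i \<in> T" "e i \<in> S" if "i < m" for i
    using e T(1) that by (auto simp: bij_betw_def)
  have arcs_in: "x \<in> set p \<and> y \<in> set p" if "(x, y) \<in> set (vwalk_arcs p)" for x y :: 'a and p
    using that by (induction p rule: vwalk_arcs.induct) auto
  have arc_path: "(x, y) \<in> set (vwalk_arcs (P s))" if "(x, y) \<in> F" "s \<in> S" "x \<in> set (P s) \<or> y \<in> set (P s)" for x y s
  proof -
    have "(x, y) \<in> (\<Union>s\<in>S. set (vwalk_arcs (P s)))" using that(1) by (simp only: P(2))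
    then obtain s' where "s' \<in> S" "(x, y) \<in> set (vwalk_arcs (P s'))" by blast
    then show ?thesis using arcs_in[of x y "P s'"] Pdisj that(2,3) by metis
  qed
  have last_no_arc: "(last p, y) \<notin> set (vwalk_arcs p)" if "distinct p" for p :: "'a list" and y
    using that by (induction p rule: vwalk_arcs.induct) (auto dest: arcs_in)
  interpret switching S H F c U t m
  proof
    show "rooted_forest S F" "F \<subseteq> H" "inj_on c F" using F by auto
    show "x \<in> U" if xy: "(x, y) \<in> F" "y \<in> U" for x y
    proof -
      obtain s where s: "s \<in> T" "y \<in> set (P s)" using xy by (auto simp: U_def)
      then have "x \<in> set (P s)" using arc_path[OF xy(1), of s] arcs_in T(1) by blast
      then show ?thesis using s by (auto simp: U_def)
    qed
    show "t i \<in> U \<and> t i \<notin> Domain F \<and> t i \<in> S \<union> Range F" if "i < m" for i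
    proof -
      have i: "t i \<in> set (P (e i))" using Pne eT(2)[OF that] by (simp add: t_def)
      have "t i \<notin> Domain F"
        using arc_path[OF _ eT(2)[OF that]] i last_no_arc[OF Pne(2)[OF eT(2)[OF that]]]
        by (auto simp: t_def)
      then show ?thesis using i eT[OF that] P(3) by (auto simp: U_def)
    qed
    show "inj_on t {..<m}"
    proof (rule inj_onI)
      fix i i' assume *: "i \<in> {..<m}" "i' \<in> {..<m}" "t i = t i'"
      have end_in: "t k \<in> set (P (e k))" if "k < m" for k
        using Pne(1)[OF eT(2)[OF that]] by (simp add: t_def)
      have "e i = e i'"
      proof (rule Pdisj)
        show "t i \<in> set (P (e i))" "t i \<in> set (P (e i'))"
          using end_in[of i] end_in[of i'] * by auto
      qed (use eT * in auto)
      then show "i = i'" using bij_betw_imp_inj_on[OF e] * by (auto dest: inj_onD)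
    qed
  qed
  \<comment> \<open>The guaranteed gain per round; it may be negative, in which case the bound is trivial.\<close>
  define g where "g = real N - card S - card U - card F"
  have tV: "t i \<in> V" if "i < m" for i using t[OF that] F HV SV by blast
  have "real j * g \<le> card (freed j)" if "j \<le> m" for j
    using that
  proof (induction j)
    case (Suc j)
    have "N + card (freed j) \<le> card (freed (Suc j)) + card F + card U + card S"
      using Suc.prems tV[of j] by (intro freed_grows maxF) (auto simp: finS finU finH deg proper)
    then have "g + card (freed j) \<le> card (freed (Suc j))" unfolding g_def by linarith
    then show ?case using Suc by (simp add: algebra_simps del: freed.simps)
  qed auto
  then have "real m * g \<le> card (freed m)" by simp
  also have "card (freed m) \<le> card F"
    using freed_subset F by (intro card_mono) (auto simp: rooted_forest_def linear_digraph_def)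
  also have "card F = card (Range F)" using F by (simp add: rooted_forest_def linear_card_Range)
  also have "\<dots> \<le> card V" using F HV fin by (intro card_mono) auto
  finally have "g \<le> card V / real m" using m by (simp add: field_simps)
  then have "real (card F) \<ge> real N - card S - real m * card V / card S - card V / real m"
    using U_le unfolding g_def by linarith
  then show thesis using F that by blast
qed

section \<open>Random subsets of a finite set\<close>

text \<open>
  A random subset of a finite set \<open>X\<close> that contains each element independently with probability
  \<open>p\<close>. As \<open>X\<close> is finite, the expectation is a weighted sum over the subsets, and independence is
  the product formula \<open>expect_Un\<close>.
\<close>
definition random_weight :: "real \<Rightarrow> 'a set \<Rightarrow> 'a set \<Rightarrow> real" where
  "random_weight p X Z = p ^ card Z * (1 - p) ^ card (X - Z)"

definition expect :: "real \<Rightarrow> 'a set \<Rightarrow> ('a set \<Rightarrow> real) \<Rightarrow> real" where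
  "expect p X f = (\<Sum>Z\<in>Pow X. random_weight p X Z * f Z)"

lemma expect_Un:
  assumes "finite A" "finite B" "A \<inter> B = {}"
  shows "expect p (A \<union> B) (\<lambda>Z. f (Z \<inter> A) * g (Z \<inter> B)) = expect p A f * expect p B g"
proof -
  have bij: "bij_betw (\<lambda>(Y, Z). Y \<union> Z) (Pow A \<times> Pow B) (Pow (A \<union> B))"
  proof (rule bij_betwI[where g = "\<lambda>Z. (Z \<inter> A, Z \<inter> B)"])
    show "(\<lambda>(Y, Z). Y \<union> Z) \<in> Pow A \<times> Pow B \<rightarrow> Pow (A \<union> B)" by fast
    show "(\<lambda>Z. (Z \<inter> A, Z \<inter> B)) \<in> Pow (A \<union> B) \<rightarrow> Pow A \<times> Pow B" by fast
    show "((case x of (Y, Z) \<Rightarrow> Y \<union> Z) \<inter> A, (case x of (Y, Z) \<Rightarrow> Y \<union> Z) \<inter> B) = x"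
      if "x \<in> Pow A \<times> Pow B" for x
    proof (cases x)
      case (Pair Y Z)
      then have "(Y \<union> Z) \<inter> A = Y" "(Y \<union> Z) \<inter> B = Z" using that assms(3) by blast+
      then show ?thesis using Pair by simp
    qed
    show "(case (Z \<inter> A, Z \<inter> B) of (Y, Z) \<Rightarrow> Y \<union> Z) = Z" if "Z \<in> Pow (A \<union> B)" for Z
      using that by (simp add: Int_Un_distrib[symmetric] Int_absorb2)
  qed
  have "expect p (A \<union> B) (\<lambda>Z. f (Z \<inter> A) * g (Z \<inter> B)) =
    (\<Sum>(Y, Z)\<in>Pow A \<times> Pow B. random_weight p (A \<union> B) (Y \<union> Z) * (f ((Y \<union> Z) \<inter> A) * g ((Y \<union> Z) \<inter> B)))"
    unfolding expect_def by (subst sum.reindex_bij_betw[OF bij, symmetric]) (simp add: case_prod_unfold)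
  also have "\<dots> = (\<Sum>(Y, Z)\<in>Pow A \<times> Pow B. (random_weight p A Y * f Y) * (random_weight p B Z * g Z))"
  proof (intro sum.cong refl, clarify)
    fix Y Z assume YZ: "Y \<subseteq> A" "Z \<subseteq> B"
    have "(Y \<union> Z) \<inter> A = Y" "(Y \<union> Z) \<inter> B = Z" using YZ assms(3) by auto
    moreover have "card (Y \<union> Z) = card Y + card Z"
      using YZ assms by (intro card_Un_disjoint) (auto intro: finite_subset)
    moreover have "A \<union> B - (Y \<union> Z) = (A - Y) \<union> (B - Z)" using YZ assms(3) by auto
    moreover have "card ((A - Y) \<union> (B - Z)) = card (A - Y) + card (B - Z)"
      using assms by (intro card_Un_disjoint) auto
    ultimately show "random_weight p (A \<union> B) (Y \<union> Z) * (f ((Y \<union> Z) \<inter> A) * g ((Y \<union> Z) \<inter> B)) =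
        (random_weight p A Y * f Y) * (random_weight p B Z * g Z)"
      by (simp add: random_weight_def power_add)
  qed
  also have "\<dots> = expect p A f * expect p B g"
    unfolding expect_def by (simp add: sum_product sum.cartesian_product)
  finally show ?thesis .
qed

lemma expect_singleton: "expect p {x} f = p * f {x} + (1 - p) * f {}"
  by (simp add: expect_def random_weight_def Pow_insert)

lemma expect_empty [simp]: "expect p {} f = f {}"
  by (simp add: expect_def random_weight_def)

lemma expect_cong: "(\<And>Z. Z \<subseteq> X \<Longrightarrow> f Z = g Z) \<Longrightarrow> expect p X f = expect p X g"
  unfolding expect_def by (intro sum.cong) auto

lemma expect_const [simp]: "finite X \<Longrightarrow> expect p X (\<lambda>_. k) = k"
proof (induction X rule: finite_induct)
  case (insert x X)
  have "expect p ({x} \<union> X) (\<lambda>_. k) = expect p {x} (\<lambda>_. 1) * expect p X (\<lambda>_. k)"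
    using expect_Un[of "{x}" X p "\<lambda>_. 1" "\<lambda>_. k"] insert by simp
  then show ?case using insert by (simp add: expect_singleton)
qed simp

lemma expect_restrict:
  assumes "finite X" "A \<subseteq> X"
  shows "expect p X (\<lambda>Z. f (Z \<inter> A)) = expect p A f"
proof -
  have "finite A" "A \<union> (X - A) = X" using assms finite_subset by auto
  then show ?thesis using expect_Un[of A "X - A" p f "\<lambda>_. 1"] assms by simp
qed

lemma expect_prod_blocks:
  assumes "finite X" "finite \<B>" "disjoint_family_on B \<B>" "\<And>b. b \<in> \<B> \<Longrightarrow> B b \<subseteq> X"
  shows "expect p X (\<lambda>Z. \<Prod>b\<in>\<B>. f b (Z \<inter> B b)) = (\<Prod>b\<in>\<B>. expect p (B b) (f b))"
  using assms(2-4)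
proof (induction \<B> rule: finite_induct)
  case empty
  then show ?case using assms(1) by simp
next
  case (insert b \<B>)
  let ?U = "\<Union>(B ` \<B>)"
  have fin: "finite (B b)" "finite ?U" "B b \<subseteq> X" "?U \<subseteq> X"
    using insert.prems(2) insert.hyps(1) assms(1) finite_subset by (auto intro!: finite_UN_I) blast+
  have disj: "B b \<inter> ?U = {}"
  proof -
    have "B b \<inter> B b' = {}" if "b' \<in> \<B>" for b'
      using insert.prems(1) insert.hyps(2) that by (auto simp: disjoint_family_on_def)
    then show ?thesis by blast
  qed
  have IH: "expect p X (\<lambda>Z. \<Prod>b\<in>\<B>. f b (Z \<inter> B b)) = (\<Prod>b\<in>\<B>. expect p (B b) (f b))"
    using insert.prems by (intro insert.IH) (auto simp: disjoint_family_on_def)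
  let ?h = "\<lambda>Z. \<Prod>b\<in>\<B>. f b (Z \<inter> B b)"
  have h: "?h (Z \<inter> ?U) = ?h Z" for Z
  proof (intro prod.cong refl)
    fix b' assume "b' \<in> \<B>"
    then have "Z \<inter> ?U \<inter> B b' = Z \<inter> B b'" by blast
    then show "f b' (Z \<inter> ?U \<inter> B b') = f b' (Z \<inter> B b')" by simp
  qed
  have "expect p X (\<lambda>Z. \<Prod>b\<in>insert b \<B>. f b (Z \<inter> B b)) =
      expect p X (\<lambda>Z. (\<lambda>Z. f b (Z \<inter> B b) * ?h (Z \<inter> ?U)) (Z \<inter> (B b \<union> ?U)))"
  proof (rule expect_cong)
    fix Z
    have "Z \<inter> (B b \<union> ?U) \<inter> B b = Z \<inter> B b" "Z \<inter> (B b \<union> ?U) \<inter> ?U = Z \<inter> ?U" by blast+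
    then show "(\<Prod>b\<in>insert b \<B>. f b (Z \<inter> B b)) =
        (\<lambda>Z. f b (Z \<inter> B b) * ?h (Z \<inter> ?U)) (Z \<inter> (B b \<union> ?U))"
      by (simp only: h prod.insert[OF insert.hyps])
  qed
  also have "\<dots> = expect p (B b \<union> ?U) (\<lambda>Z. f b (Z \<inter> B b) * ?h (Z \<inter> ?U))"
    using fin by (intro expect_restrict[OF assms(1), where f = "\<lambda>Z. f b (Z \<inter> B b) * ?h (Z \<inter> ?U)"]) auto
  also have "\<dots> = expect p (B b) (f b) * expect p ?U ?h"
    by (rule expect_Un[OF fin(1,2) disj, of p "f b" ?h])
  also have "expect p ?U ?h = expect p X (\<lambda>Z. ?h (Z \<inter> ?U))"
    by (rule expect_restrict[OF assms(1) fin(4), of p ?h, symmetric])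
  also have "\<dots> = (\<Prod>b\<in>\<B>. expect p (B b) (f b))"
    using IH h by simp
  finally show ?case using insert.hyps by simp
qed

lemma expect_sum: "expect p X (\<lambda>Z. \<Sum>i\<in>I. f i Z) = (\<Sum>i\<in>I. expect p X (f i))"
  unfolding expect_def by (subst sum.swap) (simp add: sum_distrib_left)

lemma expect_add: "expect p X (\<lambda>Z. f Z + g Z) = expect p X f + expect p X g"
  unfolding expect_def by (simp add: algebra_simps sum.distrib)

lemma expect_cmult: "expect p X (\<lambda>Z. k * f Z) = k * expect p X f"
  unfolding expect_def by (simp add: sum_distrib_left mult.left_commute)

lemma expect_mono:
  assumes "0 \<le> p" "p \<le> 1" "\<And>Z. Z \<subseteq> X \<Longrightarrow> f Z \<le> g Z"
  shows "expect p X f \<le> expect p X g"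
  unfolding expect_def
  by (intro sum_mono mult_left_mono assms(3)) (use assms in \<open>auto simp: random_weight_def\<close>)

text \<open>
  Exponential moments for the two Chernoff bounds below: base \<open>1/2\<close> controls the lower tail of the
  number of contained blocks, base \<open>2\<close> the upper tail of the size.
\<close>
lemma expect_half_power_contained:
  assumes "finite X" "finite \<B>" "disjoint_family_on B \<B>" "\<And>b. b \<in> \<B> \<Longrightarrow> B b \<subseteq> X \<and> card (B b) = k"
  shows "expect p X (\<lambda>Z. (1/2) ^ card {b\<in>\<B>. B b \<subseteq> Z}) = (1 - p ^ k / 2) ^ card \<B>"
proof -
  have "(1/2::real) ^ card {b\<in>\<B>. B b \<subseteq> Z} = (\<Prod>b\<in>\<B>. if B b \<subseteq> Z \<inter> B b then 1/2 else 1)" for Z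
  proof -
    have "(\<Prod>b\<in>\<B>. if B b \<subseteq> Z \<inter> B b then 1/2 else (1::real)) =
        (\<Prod>b\<in>\<B>. if B b \<subseteq> Z then 1/2 else 1)" by simp
    also have "\<dots> = (1/2) ^ card {b\<in>\<B>. B b \<subseteq> Z}"
      using assms(2) by (simp add: prod.If_cases Int_def)
    finally show ?thesis by simp
  qed
  then have "expect p X (\<lambda>Z. (1/2) ^ card {b\<in>\<B>. B b \<subseteq> Z}) =
      (\<Prod>b\<in>\<B>. expect p (B b) (\<lambda>Z. if B b \<subseteq> Z then 1/2 else 1))"
    using expect_prod_blocks[OF assms(1-3), where f = "\<lambda>b Z. if B b \<subseteq> Z then 1/2 else 1"] assms(4) by simp
  also have "\<dots> = (\<Prod>b\<in>\<B>. 1 - p ^ k / 2)"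
  proof (intro prod.cong refl)
    fix b assume b: "b \<in> \<B>"
    then have finb: "finite (B b)" and k: "card (B b) = k" using assms(1,4) finite_subset by blast+
    have "expect p (B b) (\<lambda>Z. if B b \<subseteq> Z then 1/2 else 1) =
        expect p (B b) (\<lambda>Z. 1 + (if Z = B b then - 1/2 else 0))"
      by (intro expect_cong) auto
    also have "\<dots> = 1 + expect p (B b) (\<lambda>Z. if Z = B b then - 1/2 else 0)"
      using finb by (simp add: expect_add)
    also have "expect p (B b) (\<lambda>Z. if Z = B b then - 1/2 else 0) = - (p ^ k / 2)"
      using finb k unfolding expect_def
      by (subst sum.remove[of _ "B b"]) (auto simp: random_weight_def)
    finally show "expect p (B b) (\<lambda>Z. if B b \<subseteq> Z then 1/2 else 1) = 1 - p ^ k / 2" by simp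
  qed
  finally show ?thesis by simp
qed

lemma expect_two_power_card:
  assumes "finite X" "A \<subseteq> X"
  shows "expect p X (\<lambda>Z. 2 ^ card (Z \<inter> A)) = (1 + p) ^ card A"
proof -
  have finA: "finite A" using assms finite_subset by auto
  have "(2::real) ^ card (Z \<inter> A) = (\<Prod>a\<in>A. if a \<in> Z \<inter> {a} then 2 else 1)" for Z
    using finA by (simp add: prod.If_cases Int_def conj_commute)
  then have "expect p X (\<lambda>Z. 2 ^ card (Z \<inter> A)) = (\<Prod>a\<in>A. expect p {a} (\<lambda>Z. if a \<in> Z then 2 else 1))"
    using expect_prod_blocks[OF assms(1) finA, where B = "\<lambda>a. {a}" and p = p and f = "\<lambda>a Z. if a \<in> Z then 2 else 1"] assms(2)
    by (auto simp: disjoint_family_on_def)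
  also have "\<dots> = (1 + p) ^ card A" by (simp add: expect_singleton add.commute)
  finally show ?thesis .
qed

text \<open>
  The first moment method. For a subset that violates one of the requirements, one of the summands
  \<open>2 ^ M * (1/2) ^ card {\<dots>}\<close> or \<open>2 ^ card (\<dots>) / 2 ^ K\<close> is at least 1, while the
  expectation of their total is at most the quantity that is assumed to be less than 1.
\<close>
theorem exists_well_distributed_subset:
  fixes B :: "'i \<Rightarrow> 'b \<Rightarrow> 'a set" and A :: "'j \<Rightarrow> 'a set"
  assumes X: "finite X" and p: "0 \<le> p" "p \<le> 1" and fin: "finite I" "finite J"
    and B: "\<And>i. i \<in> I \<Longrightarrow> finite (\<B> i) \<and> disjoint_family_on (B i) (\<B> i) \<and> N \<le> card (\<B> i)"
      "\<And>i b. i \<in> I \<Longrightarrow> b \<in> \<B> i \<Longrightarrow> B i b \<subseteq> X \<and> card (B i b) = k"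
    and A: "\<And>j. j \<in> J \<Longrightarrow> A j \<subseteq> X \<and> card (A j) \<le> n"
    and small: "card I * (2 ^ M * (1 - p ^ k / 2) ^ N) + card J * ((1 + p) ^ n / 2 ^ K) < 1"
  shows "\<exists>Z\<subseteq>X. (\<forall>i\<in>I. M \<le> card {b\<in>\<B> i. B i b \<subseteq> Z}) \<and> (\<forall>j\<in>J. card (Z \<inter> A j) \<le> K)"
proof (rule ccontr)
  assume neg: "\<not> ?thesis"
  let ?f = "\<lambda>i Z. 2 ^ M * (1/2::real) ^ card {b\<in>\<B> i. B i b \<subseteq> Z}"
  let ?g = "\<lambda>j Z. (1 / 2 ^ K) * (2::real) ^ card (Z \<inter> A j)"
  have "1 \<le> (\<Sum>i\<in>I. ?f i Z) + (\<Sum>j\<in>J. ?g j Z)" if ZX: "Z \<subseteq> X" for Z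
  proof -
    have nonneg: "0 \<le> (\<Sum>i\<in>I. ?f i Z)" "0 \<le> (\<Sum>j\<in>J. ?g j Z)" by (auto intro!: sum_nonneg)
    have "(\<exists>i\<in>I. card {b\<in>\<B> i. B i b \<subseteq> Z} < M) \<or> (\<exists>j\<in>J. K < card (Z \<inter> A j))"
      using neg ZX by (meson not_le)
    then consider i where "i \<in> I" "card {b\<in>\<B> i. B i b \<subseteq> Z} < M"
      | j where "j \<in> J" "K < card (Z \<inter> A j)" by blast
    then show ?thesis
    proof cases
      case 1
      have "1 \<le> ?f i Z"
        using 1(2) by (simp add: power_one_over field_simps power_increasing)
      also have "\<dots> \<le> (\<Sum>i\<in>I. ?f i Z)" using 1(1) fin(1) by (intro member_le_sum) auto
      finally show ?thesis using nonneg by linarith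
    next
      case 2
      have "1 \<le> ?g j Z"
        using 2(2) by (simp add: field_simps power_increasing)
      also have "\<dots> \<le> (\<Sum>j\<in>J. ?g j Z)" using 2(1) fin(2) by (intro member_le_sum) auto
      finally show ?thesis using nonneg by linarith
    qed
  qed
  then have "expect p X (\<lambda>_. 1) \<le> expect p X (\<lambda>Z. (\<Sum>i\<in>I. ?f i Z) + (\<Sum>j\<in>J. ?g j Z))"
    by (intro expect_mono p)
  also have "\<dots> = (\<Sum>i\<in>I. 2 ^ M * expect p X (\<lambda>Z. (1/2) ^ card {b\<in>\<B> i. B i b \<subseteq> Z})) +
      (\<Sum>j\<in>J. (1 / 2 ^ K) * expect p X (\<lambda>Z. 2 ^ card (Z \<inter> A j)))"
    by (simp only: expect_add expect_sum expect_cmult)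
  also have "\<dots> \<le> (\<Sum>i\<in>I. 2 ^ M * (1 - p ^ k / 2) ^ N) + (\<Sum>j\<in>J. (1 / 2 ^ K) * (1 + p) ^ n)"
  proof (intro add_mono sum_mono mult_left_mono)
    fix i assume i: "i \<in> I"
    have "p ^ k \<le> 1" "0 \<le> p ^ k" using p by (auto simp: power_le_one)
    then show "expect p X (\<lambda>Z. (1/2) ^ card {b\<in>\<B> i. B i b \<subseteq> Z}) \<le> (1 - p ^ k / 2) ^ N"
      using B[OF i] expect_half_power_contained[OF X, of "\<B> i" "B i" k p]
      by (simp add: power_decreasing)
  next
    fix j assume j: "j \<in> J"
    then show "expect p X (\<lambda>Z. 2 ^ card (Z \<inter> A j)) \<le> (1 + p) ^ n"
      using A[OF j] expect_two_power_card[OF X, of "A j" p] p by (simp add: power_increasing)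
  qed auto
  also have "\<dots> < 1" using small by simp
  finally show False using X by simp
qed

section \<open>A reservoir of connecting vertices and colours\<close>

text \<open>Greedy choice: each chosen element excludes itself and at most \<open>k\<close> others.\<close>
lemma independent_subset:
  assumes "finite G" "\<And>g h. R g h \<Longrightarrow> R h g" "\<And>g. g \<in> G \<Longrightarrow> card {h \<in> G. R g h} \<le> k"
  shows "\<exists>I\<subseteq>G. pairwise (\<lambda>g h. \<not> R g h) I \<and> card G \<le> (k + 1) * card I"
  using assms(1,3)
proof (induction G rule: finite_psubset_induct)
  case (psubset G)
  show ?case
  proof (cases "G = {}")
    case False
    then obtain g where g: "g \<in> G" by blast
    let ?N = "{h \<in> G. R g h}"
    let ?G = "G - insert g ?N"
    have "\<exists>I\<subseteq>?G. pairwise (\<lambda>g h. \<not> R g h) I \<and> card ?G \<le> (k + 1) * card I"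
    proof (rule psubset.IH)
      show "?G \<subset> G" using g by blast
      show "card {h' \<in> ?G. R h h'} \<le> k" if "h \<in> ?G" for h
      proof -
        have "card {h' \<in> ?G. R h h'} \<le> card {h' \<in> G. R h h'}"
          using psubset.hyps by (intro card_mono) auto
        then show ?thesis using psubset.prems[of h] that by simp
      qed
    qed
    then obtain I where I: "I \<subseteq> ?G" "pairwise (\<lambda>g h. \<not> R g h) I" "card ?G \<le> (k + 1) * card I"
      by blast
    have finI: "finite I" using I(1) psubset.hyps by (meson finite_Diff finite_subset)
    have "card G \<le> card ?G + card (insert g ?N)"
      using psubset.hyps diff_card_le_card_Diff[of "insert g ?N" G] by simp
    also have "card (insert g ?N) \<le> k + 1"
      using psubset.prems[OF g] psubset.hyps by (auto simp: card_insert_if)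
    finally have "card G \<le> (k + 1) * card (insert g I)"
      using I(1,3) finI by (subst card_insert_disjoint) auto
    moreover have "pairwise (\<lambda>g h. \<not> R g h) (insert g I)"
      using I(1,2) assms(2) unfolding pairwise_insert by blast
    ultimately show ?thesis using I(1) g by (intro exI[of _ "insert g I"]) auto
  qed auto
qed

locale proper_colouring =
  fixes V :: "'a set" and c :: "'a \<times> 'a \<Rightarrow> 'c"
  assumes finV: "finite V"
    and out_inj: "\<And>x. x \<in> V \<Longrightarrow> inj_on (\<lambda>v. c (x, v)) (V - {x})"
    and in_inj: "\<And>y. y \<in> V \<Longrightarrow> inj_on (\<lambda>v. c (v, y)) (V - {y})"
begin

text \<open>
  The possible inner vertices of a rainbow path of length two from \<open>x\<close> to \<open>y\<close>. Such a path is
  available for linking if the three elements of its block, a vertex and two colours, are all selected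
  in the random choice.
\<close>
definition middles :: "'a \<Rightarrow> 'a \<Rightarrow> 'a set" where
  "middles x y = {w \<in> V - {x, y}. c (x, w) \<noteq> c (w, y)}"

definition block :: "'a \<Rightarrow> 'a \<Rightarrow> 'a \<Rightarrow> ('a + 'c) set" where
  "block x y w = {Inl w, Inr (c (x, w)), Inr (c (w, y))}"

lemma finite_middles [simp]: "finite (middles x y)"
  using finV by (simp add: middles_def)

text \<open>
  For a single pair \<open>x\<close>, \<open>y\<close> there may be no middle vertex at all: a proper colouring may give
  \<open>(x, w)\<close> and \<open>(w, y)\<close> the same colour for every \<open>w\<close>. But \<open>(x, w)\<close> and \<open>(x', w)\<close> have
  different colours, so each \<open>w\<close> is a middle vertex for \<open>x\<close> or for \<open>x'\<close>.
\<close>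
lemma many_middles:
  assumes "x \<in> V" "x' \<in> V" "y \<in> V" "x \<noteq> x'"
  shows "card V \<le> 2 * card (middles x y) + 3 \<or> card V \<le> 2 * card (middles x' y) + 3"
proof -
  have "V - {x, x', y} \<subseteq> middles x y \<union> middles x' y"
  proof
    fix w assume w: "w \<in> V - {x, x', y}"
    then have "c (x, w) \<noteq> c (x', w)"
      using in_inj[of w] assms by (auto dest: inj_onD)
    then show "w \<in> middles x y \<union> middles x' y" using w by (auto simp: middles_def)
  qed
  then have "card (V - {x, x', y}) \<le> card (middles x y) + card (middles x' y)"
    by (meson card_Un_le card_mono finite_Un finite_middles le_trans)
  moreover have "card V - card {x, x', y} \<le> card (V - {x, x', y})"
    by (rule diff_card_le_card_Diff) simp
  moreover have "card {x, x', y} \<le> 3" by (auto simp: card_insert_if)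
  ultimately show ?thesis by linarith
qed

text \<open>
  Two blocks can meet only if the first edge of one path has the colour of the second edge of the
  other. By properness this happens for at most two partners of a given \<open>w\<close>, so a third of the
  blocks can be chosen pairwise disjoint, hence independent in the random choice.
\<close>
lemma disjoint_blocks:
  assumes "x \<in> V" "y \<in> V"
  shows "\<exists>I\<subseteq>middles x y. disjoint_family_on (block x y) I \<and> card (middles x y) \<le> 3 * card I"
proof -
  let ?R = "\<lambda>w w'. w \<noteq> w' \<and> (c (x, w) = c (w', y) \<or> c (w, y) = c (x, w'))"
  have out: "inj_on (\<lambda>v. c (x, v)) (middles x y)" and inn: "inj_on (\<lambda>v. c (v, y)) (middles x y)"
    using out_inj[OF assms(1)] in_inj[OF assms(2)]
    by (auto simp: middles_def intro: inj_on_subset)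
  have deg: "card {w' \<in> middles x y. ?R w w'} \<le> 2" for w
  proof -
    have le1: "card {v \<in> A. f v = k} \<le> 1" if "inj_on f A" "finite A" for f :: "'a \<Rightarrow> 'c" and A k
      using that unfolding One_nat_def
      by (subst card_le_Suc0_iff_eq) (auto dest: inj_onD)
    have "{w' \<in> middles x y. ?R w w'} \<subseteq>
      {w' \<in> middles x y. c (w', y) = c (x, w)} \<union> {w' \<in> middles x y. c (x, w') = c (w, y)}"
      by auto
    then have "card {w' \<in> middles x y. ?R w w'} \<le>
      card ({w' \<in> middles x y. c (w', y) = c (x, w)} \<union> {w' \<in> middles x y. c (x, w') = c (w, y)})"
      by (intro card_mono) auto
    also have "\<dots> \<le> card {w' \<in> middles x y. c (w', y) = c (x, w)} +
        card {w' \<in> middles x y. c (x, w') = c (w, y)}" by (rule card_Un_le)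
    also have "\<dots> \<le> 1 + 1" by (intro add_mono le1 out inn) auto
    finally show ?thesis by simp
  qed
  have "\<exists>I\<subseteq>middles x y. pairwise (\<lambda>w w'. \<not> ?R w w') I \<and> card (middles x y) \<le> (2 + 1) * card I"
    by (rule independent_subset[OF finite_middles _ deg]) fastforce
  then obtain I where I: "I \<subseteq> middles x y" "pairwise (\<lambda>w w'. \<not> ?R w w') I"
      "card (middles x y) \<le> (2 + 1) * card I" by blast
  have "disjoint_family_on (block x y) I"
    unfolding disjoint_family_on_def
  proof (intro ballI impI)
    fix w w' assume w: "w \<in> I" "w' \<in> I" "w \<noteq> w'"
    then have "w \<in> middles x y" "w' \<in> middles x y" using I(1) by blast+
    then have "c (x, w) \<noteq> c (x, w')" "c (w, y) \<noteq> c (w', y)"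
      using inj_onD[OF out, of w w'] inj_onD[OF inn, of w w'] w(3) by blast+
    moreover have "c (x, w) \<noteq> c (w', y)" "c (w, y) \<noteq> c (x, w')"
      using I(2) w by (auto simp: pairwise_def)
    ultimately show "block x y w \<inter> block x y w' = {}" using w(3) by (auto simp: block_def)
  qed
  then show ?thesis using I by auto
qed

definition connectors :: "'a set \<Rightarrow> 'c set \<Rightarrow> 'a \<Rightarrow> 'a \<Rightarrow> 'a set" where
  "connectors W R x y = {w \<in> W \<inter> middles x y. c (x, w) \<in> R \<and> c (w, y) \<in> R}"

text \<open>
  Select vertices and colours at random with probability \<open>p\<close>. A block has three elements, so among
  the \<open>(card V - 3) div 6\<close> disjoint ones about a fraction \<open>p ^ 3\<close> is selected; the upper
  tail bounds the number of reserved vertices and, at each vertex, of edges with a reserved colour.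
\<close>
theorem exists_reservoir:
  assumes p: "0 \<le> p" "p \<le> 1"
    and small: "real (card V ^ 2) * (2 ^ M * (1 - p ^ 3 / 2) ^ ((card V - 3) div 6)) +
      real (card V + 1) * ((1 + p) ^ card V / 2 ^ K) < 1"
  obtains W R where "W \<subseteq> V" "card W \<le> K"
    "\<And>x. x \<in> V \<Longrightarrow> card {v \<in> V - {x}. c (x, v) \<in> R} \<le> K"
    "\<And>x x' y. x \<in> V \<Longrightarrow> x' \<in> V \<Longrightarrow> y \<in> V \<Longrightarrow> x \<noteq> x' \<Longrightarrow> x \<noteq> y \<Longrightarrow> x' \<noteq> y \<Longrightarrow>
      M \<le> card (connectors W R x y) \<or> M \<le> card (connectors W R x' y)"
proof -
  define X :: "('a + 'c) set" where "X = Inl ` V \<union> Inr ` c ` (V \<times> V)"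
  define I where "I = {(x, y) \<in> V \<times> V. x \<noteq> y \<and> card V \<le> 2 * card (middles x y) + 3}"
  \<comment> \<open>The index \<open>None\<close> stands for the vertex set, \<open>Some x\<close> for the colours of the edges out of \<open>x\<close>.\<close>
  define J where "J = insert None (Some ` V)"
  define A :: "'a option \<Rightarrow> ('a + 'c) set" where
    "A j = (case j of None \<Rightarrow> Inl ` V | Some x \<Rightarrow> Inr ` (\<lambda>v. c (x, v)) ` (V - {x}))" for j
  have "\<forall>i\<in>I. \<exists>b. b \<subseteq> middles (fst i) (snd i) \<and> disjoint_family_on (block (fst i) (snd i)) b \<and>
      card (middles (fst i) (snd i)) \<le> 3 * card b"
    using disjoint_blocks by (force simp: I_def)
  then obtain \<B> where \<B>: "\<And>i. i \<in> I \<Longrightarrow> \<B> i \<subseteq> middles (fst i) (snd i) \<and>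
      disjoint_family_on (block (fst i) (snd i)) (\<B> i) \<and>
      card (middles (fst i) (snd i)) \<le> 3 * card (\<B> i)"
    by metis
  have finI: "finite I" and cardI: "card I \<le> card V ^ 2"
  proof -
    have "I \<subseteq> V \<times> V" by (auto simp: I_def)
    then show "finite I" "card I \<le> card V ^ 2"
      using finV card_mono[of "V \<times> V" I] by (auto simp: power2_eq_square finite_subset)
  qed
  have finJ: "finite J" and cardJ: "card J \<le> card V + 1"
    using finV card_image_le[OF finV, of Some] by (auto simp: J_def card_insert_if)
  have "\<exists>Z\<subseteq>X. (\<forall>i\<in>I. M \<le> card {b\<in>\<B> i. block (fst i) (snd i) b \<subseteq> Z}) \<and>
      (\<forall>j\<in>J. card (Z \<inter> A j) \<le> K)"
  proof (rule exists_well_distributed_subset[where k = 3 and n = "card V" and N = "(card V - 3) div 6" and p = p])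
    show "finite X" using finV by (simp add: X_def)
    show "finite (\<B> i) \<and> disjoint_family_on (block (fst i) (snd i)) (\<B> i) \<and>
        (card V - 3) div 6 \<le> card (\<B> i)" if "i \<in> I" for i
    proof -
      have "card V \<le> 2 * card (middles (fst i) (snd i)) + 3" using that by (auto simp: I_def)
      then have "(card V - 3) div 6 \<le> card (\<B> i)" using \<B>[OF that] by linarith
      then show ?thesis using \<B>[OF that] finite_middles finite_subset by blast
    qed
    show "block (fst i) (snd i) b \<subseteq> X \<and> card (block (fst i) (snd i) b) = 3"
      if "i \<in> I" "b \<in> \<B> i" for i b
    proof -
      have "b \<in> middles (fst i) (snd i)" "fst i \<in> V" "snd i \<in> V"
        using \<B>[OF that(1)] that by (auto simp: I_def)
      then show ?thesis by (auto simp: block_def X_def middles_def)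
    qed
    show "A j \<subseteq> X \<and> card (A j) \<le> card V" if "j \<in> J" for j
    proof (cases j)
      case None
      then show ?thesis by (simp add: A_def X_def card_image)
    next
      case (Some x)
      then have "x \<in> V" using that by (auto simp: J_def)
      moreover have "card (A j) \<le> card (V - {x})"
        unfolding A_def Some option.case image_image using finV by (intro card_image_le) simp
      moreover have "card (V - {x}) \<le> card V" using finV by (simp add: card_mono)
      ultimately show ?thesis by (auto simp: A_def Some X_def)
    qed
    have p3: "0 \<le> 1 - p ^ 3 / 2" using power_le_one[OF p, of 3] by simp
    have "real (card I) * (2 ^ M * (1 - p ^ 3 / 2) ^ ((card V - 3) div 6)) +
        real (card J) * ((1 + p) ^ card V / 2 ^ K) \<le>
        real (card V ^ 2) * (2 ^ M * (1 - p ^ 3 / 2) ^ ((card V - 3) div 6)) +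
        real (card V + 1) * ((1 + p) ^ card V / 2 ^ K)"
      using p p3 cardI cardJ by (intro add_mono mult_right_mono) (simp_all only: of_nat_le_iff, auto)
    also note small
    finally show "real (card I) * (2 ^ M * (1 - p ^ 3 / 2) ^ ((card V - 3) div 6)) +
        real (card J) * ((1 + p) ^ card V / 2 ^ K) < 1" .
  qed (use p finI finJ in auto)
  then obtain Z where ZX: "Z \<subseteq> X"
    and Z1: "\<And>i. i \<in> I \<Longrightarrow> M \<le> card {b\<in>\<B> i. block (fst i) (snd i) b \<subseteq> Z}"
    and Z2: "\<And>j. j \<in> J \<Longrightarrow> card (Z \<inter> A j) \<le> K" by blast
  have finZ: "finite Z" using finite_subset[OF ZX] finV by (simp add: X_def)
  define W where "W = {v. Inl v \<in> Z}"
  define R where "R = {k. Inr k \<in> Z}"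
  show thesis
  proof
    show "W \<subseteq> V" using ZX by (auto simp: W_def X_def)
    have "Inl ` W \<subseteq> Z \<inter> A None" using \<open>W \<subseteq> V\<close> by (auto simp: W_def A_def)
    then have "card (Inl ` W :: ('a + 'c) set) \<le> card (Z \<inter> A None)" using finZ by (intro card_mono) auto
    then show "card W \<le> K" using Z2[of None] by (simp add: J_def card_image)
    show "card {v \<in> V - {x}. c (x, v) \<in> R} \<le> K" if x: "x \<in> V" for x
    proof -
      have "card {v \<in> V - {x}. c (x, v) \<in> R} = card ((\<lambda>v. Inr (c (x, v)) :: 'a + 'c) ` {v \<in> V - {x}. c (x, v) \<in> R})"
        using out_inj[OF x] by (intro card_image[symmetric]) (auto simp: inj_on_def)
      also have "\<dots> \<le> card (Z \<inter> A (Some x))"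
        using finZ by (intro card_mono) (auto simp: A_def R_def)
      also have "\<dots> \<le> K" using Z2 x by (simp add: J_def)
      finally show ?thesis .
    qed
    have conn: "M \<le> card (connectors W R x y)"
      if "x \<in> V" "y \<in> V" "x \<noteq> y" "card V \<le> 2 * card (middles x y) + 3" for x y
    proof -
      have i: "(x, y) \<in> I" using that by (simp add: I_def)
      have "M \<le> card {b\<in>\<B> (x, y). block x y b \<subseteq> Z}" using Z1[OF i] by simp
      also have "\<dots> \<le> card (connectors W R x y)"
        using \<B>[OF i] by (intro card_mono) (auto simp: connectors_def block_def W_def R_def)
      finally show ?thesis .
    qed
    show "M \<le> card (connectors W R x y) \<or> M \<le> card (connectors W R x' y)"
      if "x \<in> V" "x' \<in> V" "y \<in> V" "x \<noteq> x'" "x \<noteq> y" "x' \<noteq> y" for x x' y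
      using many_middles[OF that(1-4)] conn that by blast
  qed
qed

end

section \<open>Linking paths into a cycle\<close>

context proper_colouring begin

text \<open>
  The state of the greedy procedure that joins the paths \<open>Ps\<close> one after the other. A link
  replaces the last vertex of the path built so far, if necessary, by a reserved vertex; hence the
  number of vertices does not drop. Each link uses up one reserved vertex and two reserved colours.
\<close>
definition linked :: "'a set \<Rightarrow> 'c set \<Rightarrow> 'a list list \<Rightarrow> 'a list \<Rightarrow> bool" where
  "linked W R Ps Q \<longleftrightarrow> distinct Q \<and> hd Q = hd (hd Ps) \<and>
     set Q \<subseteq> \<Union>(set ` set Ps) \<union> W \<and> card (set Q \<inter> W) < length Ps \<and>
     inj_on c (set (vwalk_arcs Q)) \<and>
     {e \<in> set (vwalk_arcs Q). c e \<notin> R} \<subseteq> \<Union>((\<lambda>P. set (vwalk_arcs P)) ` set Ps) \<and>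
     card (c ` set (vwalk_arcs Q) \<inter> R) \<le> 2 * (length Ps - 1) \<and>
     length (concat Ps) \<le> length Q"

text \<open>By properness, a forbidden colour excludes at most one connector on each of its two edges.\<close>
lemma exists_free_connector:
  assumes "x \<in> V" "y \<in> V" "finite A" "finite C"
    and "card A + 2 * card C < card (connectors W R x y)"
  shows "\<exists>w\<in>connectors W R x y. w \<notin> A \<and> c (x, w) \<notin> C \<and> c (w, y) \<notin> C"
proof (rule ccontr)
  assume neg: "\<not> ?thesis"
  let ?X = "{w \<in> middles x y. c (x, w) \<in> C}" and ?Y = "{w \<in> middles x y. c (w, y) \<in> C}"
  have out: "inj_on (\<lambda>v. c (x, v)) (middles x y)" and inn: "inj_on (\<lambda>v. c (v, y)) (middles x y)"
    using out_inj[OF assms(1)] in_inj[OF assms(2)]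
    by (auto simp: middles_def intro: inj_on_subset)
  have "card ?X \<le> card C"
    by (rule card_inj_on_le[of "\<lambda>v. c (x, v)"]) (use out assms(4) in \<open>auto intro: inj_on_subset\<close>)
  moreover have "card ?Y \<le> card C"
    by (rule card_inj_on_le[of "\<lambda>v. c (v, y)"]) (use inn assms(4) in \<open>auto intro: inj_on_subset\<close>)
  moreover have "connectors W R x y \<subseteq> A \<union> (?X \<union> ?Y)"
    using neg by (auto simp: connectors_def)
  then have "card (connectors W R x y) \<le> card (A \<union> (?X \<union> ?Y))"
    using assms(3) by (intro card_mono) auto
  moreover have "card (A \<union> (?X \<union> ?Y)) \<le> card A + (card ?X + card ?Y)"
    by (meson add_left_mono card_Un_le le_trans)
  ultimately show False using assms(5) by linarith
qed

lemma butlast_arcs: "set (vwalk_arcs (butlast Q)) \<subseteq> set (vwalk_arcs Q)"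
proof (cases "Q = []")
  case False
  then show ?thesis using set_vwalk_arcs_append1[of "butlast Q" "[last Q]"] by simp
qed simp

text \<open>
  A path that is to be continued to \<open>y\<close> may end in a vertex with few connectors to \<open>y\<close>. Then the
  last but one vertex has many, and the last one is dropped. The case that \<open>y\<close> is the first vertex
  of the path is included, for closing the cycle.
\<close>
lemma exists_link:
  assumes W: "W \<subseteq> V" and Q: "distinct Q" "3 \<le> length Q" "set Q \<subseteq> V"
    and y: "y \<in> V" "y \<notin> set (tl Q)"
    and conn: "\<And>x x'. x \<in> V \<Longrightarrow> x' \<in> V \<Longrightarrow> x \<noteq> x' \<Longrightarrow> x \<noteq> y \<Longrightarrow> x' \<noteq> y \<Longrightarrow>
      M \<le> card (connectors W R x y) \<or> M \<le> card (connectors W R x' y)"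
    and few: "card (set Q \<inter> W) + 2 * card (c ` set (vwalk_arcs Q) \<inter> R) < M"
  obtains Q' w where "Q' \<noteq> []" "hd Q' = hd Q" "set Q' \<subseteq> set Q" "distinct Q'"
    "length Q \<le> length Q' + 1" "set (vwalk_arcs Q') \<subseteq> set (vwalk_arcs Q)"
    "w \<in> W" "w \<notin> set Q" "c (last Q', w) \<in> R" "c (w, y) \<in> R" "c (last Q', w) \<noteq> c (w, y)"
    "c (last Q', w) \<notin> c ` set (vwalk_arcs Q)" "c (w, y) \<notin> c ` set (vwalk_arcs Q)"
proof -
  obtain Q2 x' x where Q2: "Q = Q2 @ [x', x]"
  proof -
    obtain Q1 x where Q1: "Q = Q1 @ [x]" using Q(2) by (cases Q rule: rev_cases) auto
    then obtain Q2 x' where "Q1 = Q2 @ [x']" using Q(2) by (cases Q1 rule: rev_cases) auto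
    then show thesis using that[of Q2 x' x] Q1 by simp
  qed
  then have Q2ne: "Q2 \<noteq> []" using Q(2) by auto
  have xx: "x \<in> V" "x' \<in> V" "x \<noteq> x'" "x \<noteq> y" "x' \<noteq> y"
    using Q Q2 y(2) Q2ne by (auto simp: tl_append split: list.splits)
  let ?ok = "\<lambda>Q'. Q' \<noteq> [] \<and> hd Q' = hd Q \<and> set Q' \<subseteq> set Q \<and> distinct Q' \<and>
    length Q \<le> length Q' + 1 \<and> set (vwalk_arcs Q') \<subseteq> set (vwalk_arcs Q)"
  have "?ok Q" using Q by auto
  moreover have "?ok (Q2 @ [x'])"
    using Q Q2 Q2ne butlast_arcs[of Q] by (auto simp: butlast_append)
  ultimately obtain Q' where Q': "?ok Q'" "M \<le> card (connectors W R (last Q') y)" "last Q' \<in> V"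
    using conn[OF xx(1,2,3,4,5)] Q2 xx by (metis last_snoc append.assoc append_Cons append_Nil)
  have less: "card (set Q \<inter> W) + 2 * card (c ` set (vwalk_arcs Q) \<inter> R) < card (connectors W R (last Q') y)"
    using few Q'(2) by linarith
  obtain w where w: "w \<in> connectors W R (last Q') y" "w \<notin> set Q \<inter> W"
      "c (last Q', w) \<notin> c ` set (vwalk_arcs Q) \<inter> R" "c (w, y) \<notin> c ` set (vwalk_arcs Q) \<inter> R"
    using exists_free_connector[OF Q'(3) y(1) _ _ less] by blast
  then show thesis
    using that[of Q' w] Q'(1) by (auto simp: connectors_def middles_def)
qed

lemma exists_linked_path:
  assumes W: "W \<subseteq> V" and PV: "\<Union>(set ` set Ps) \<subseteq> V - W"
    and conn: "\<And>x x' y. x \<in> V \<Longrightarrow> x' \<in> V \<Longrightarrow> y \<in> V \<Longrightarrow> x \<noteq> x' \<Longrightarrow> x \<noteq> y \<Longrightarrow> x' \<noteq> y \<Longrightarrow>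
      M \<le> card (connectors W R x y) \<or> M \<le> card (connectors W R x' y)"
    and few: "5 * length Ps \<le> M" and ne: "Ps \<noteq> []"
    and Ps: "distinct (concat Ps)" "\<And>P. P \<in> set Ps \<Longrightarrow> 3 \<le> length P"
    and inj: "inj_on c (\<Union>((\<lambda>P. set (vwalk_arcs P)) ` set Ps))"
    and avoid: "c ` (\<Union>((\<lambda>P. set (vwalk_arcs P)) ` set Ps)) \<inter> R = {}"
  shows "\<exists>Q. linked W R Ps Q"
  using ne PV few Ps inj avoid
proof (induction Ps rule: rev_nonempty_induct)
  case (single P)
  then have "linked W R [P] P"
    unfolding linked_def by (auto simp: card_eq_0_iff image_Int_subset) 
  then show ?case ..
next
  case (snoc P Ps)
  have "\<exists>Q. linked W R Ps Q"
  proof (rule snoc.IH)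
    show "inj_on c (\<Union>((\<lambda>P. set (vwalk_arcs P)) ` set Ps))"
      using snoc.prems(5) by (rule inj_on_subset) auto
  qed (use snoc.prems in auto)
  then obtain Q where Q: "distinct Q" "hd Q = hd (hd Ps)"
     "set Q \<subseteq> \<Union>(set ` set Ps) \<union> W" "card (set Q \<inter> W) < length Ps"
     "inj_on c (set (vwalk_arcs Q))"
     "{e \<in> set (vwalk_arcs Q). c e \<notin> R} \<subseteq> \<Union>((\<lambda>P. set (vwalk_arcs P)) ` set Ps)"
     "card (c ` set (vwalk_arcs Q) \<inter> R) \<le> 2 * (length Ps - 1)"
     "length (concat Ps) \<le> length Q" unfolding linked_def by blast
  have length_hd: "3 \<le> length (concat Ps)"
    using snoc.prems(4)[of "hd Ps"] snoc.hyps by (cases Ps) auto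
  have P3: "3 \<le> length P" and Pd: "distinct P"
    and PPs: "set P \<inter> \<Union>(set ` set Ps) = {}"
    using snoc.prems(3,4) snoc.hyps by auto
  have Pne: "P \<noteq> []" using P3 by auto
  have PVW: "set P \<subseteq> V - W" "\<Union>(set ` set Ps) \<subseteq> V - W" using snoc.prems(1) by auto
  have PQ: "set P \<inter> set Q = {}" using Q(3) PPs PVW by blast
  have hdP: "hd P \<in> set P" using Pne by simp
  have QV: "set Q \<subseteq> V" using Q(3) PVW W by blast
  have Q3: "3 \<le> length Q" using Q(8) length_hd by linarith
  have hdV: "hd P \<in> V" using hdP PVW(1) by blast
  have hdQ: "hd P \<notin> set (tl Q)" using hdP PQ by (metis disjoint_iff list.sel(2) list.set_sel(2))
  have few': "card (set Q \<inter> W) + 2 * card (c ` set (vwalk_arcs Q) \<inter> R) < M"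
    using Q(4,7) snoc.prems(2) by simp
  obtain Q' w where Q': "Q' \<noteq> []" "hd Q' = hd Q" "set Q' \<subseteq> set Q" "distinct Q'"
    "length Q \<le> length Q' + 1" "set (vwalk_arcs Q') \<subseteq> set (vwalk_arcs Q)"
    and w: "w \<in> W" "w \<notin> set Q" "c (last Q', w) \<in> R" "c (w, hd P) \<in> R"
      "c (last Q', w) \<noteq> c (w, hd P)"
      "c (last Q', w) \<notin> c ` set (vwalk_arcs Q)" "c (w, hd P) \<notin> c ` set (vwalk_arcs Q)"
    by (rule exists_link[OF W Q(1) Q3 QV hdV hdQ conn few'])
      (use hdV in auto)
  let ?N = "Q' @ w # P"
  have arcs: "set (vwalk_arcs ?N) = insert (last Q', w) (insert (w, hd P) (set (vwalk_arcs Q') \<union> set (vwalk_arcs P)))"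
    using Q'(1) Pne by (auto simp: vwalk_arcs_append)
  let ?E = "\<Union>((\<lambda>P. set (vwalk_arcs P)) ` set (Ps @ [P]))"
  have cE: "c e \<notin> R" if "e \<in> ?E" for e using snoc.prems(6) that by blast
  have PE: "set (vwalk_arcs P) \<subseteq> ?E" by auto
  have injQP: "inj_on c (set (vwalk_arcs Q') \<union> set (vwalk_arcs P))"
  proof (rule inj_onI)
    fix e f assume ef: "e \<in> set (vwalk_arcs Q') \<union> set (vwalk_arcs P)"
      "f \<in> set (vwalk_arcs Q') \<union> set (vwalk_arcs P)" "c e = c f"
    show "e = f"
    proof (cases "c e \<in> R")
      case True
      then have "e \<in> set (vwalk_arcs Q)" "f \<in> set (vwalk_arcs Q)"
        using ef(1,2) cE[of e] cE[of f] True ef(3)[symmetric] PE Q'(6) by auto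
      then show ?thesis using ef(3) Q(5) by (meson inj_onD)
    next
      case False
      then have "c f \<notin> R" using ef(3) by simp
      have "g \<in> ?E" if "g \<in> set (vwalk_arcs Q') \<union> set (vwalk_arcs P)" "c g \<notin> R" for g
        using that Q'(6) Q(6) PE by auto
      then have "e \<in> ?E" "f \<in> ?E" using ef(1,2) False \<open>c f \<notin> R\<close> by blast+
      then show ?thesis using ef(3) snoc.prems(5) by (meson inj_onD)
    qed
  qed
  have newcol: "k \<notin> c ` (set (vwalk_arcs Q') \<union> set (vwalk_arcs P))"
    if "k \<in> R" "k \<notin> c ` set (vwalk_arcs Q)" for k
    using that Q'(6) cE PE by blast
  have "linked W R (Ps @ [P]) ?N"
    unfolding linked_def
  proof (intro conjI)
    show "distinct ?N" using Q'(3,4) w(1,2) PQ Pd PVW(1) by auto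
    show "hd ?N = hd (hd (Ps @ [P]))" using Q'(1,2) Q(2) snoc.hyps by simp
    show "set ?N \<subseteq> \<Union>(set ` set (Ps @ [P])) \<union> W" using Q'(3) Q(3) w(1) by auto
    have "set ?N \<inter> W \<subseteq> insert w (set Q \<inter> W)" using Q'(3) PVW(1) by auto
    then have "card (set ?N \<inter> W) \<le> card (insert w (set Q \<inter> W))" by (intro card_mono) auto
    also have "\<dots> \<le> card (set Q \<inter> W) + 1" by (simp add: card_insert_if)
    finally show "card (set ?N \<inter> W) < length (Ps @ [P])" using Q(4) by simp
    show "inj_on c (set (vwalk_arcs ?N))"
      unfolding arcs using injQP newcol[OF w(3,6)] newcol[OF w(4,7)] w(5) by auto
    show "{e \<in> set (vwalk_arcs ?N). c e \<notin> R} \<subseteq> ?E"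
      unfolding arcs using w(3,4) Q'(6) Q(6) by auto
    have "c ` set (vwalk_arcs ?N) \<inter> R \<subseteq>
        insert (c (last Q', w)) (insert (c (w, hd P)) (c ` set (vwalk_arcs Q) \<inter> R))"
      unfolding arcs using Q'(6) cE PE by auto
    then have "card (c ` set (vwalk_arcs ?N) \<inter> R) \<le>
        card (insert (c (last Q', w)) (insert (c (w, hd P)) (c ` set (vwalk_arcs Q) \<inter> R)))"
      by (intro card_mono) auto
    also have "\<dots> \<le> card (c ` set (vwalk_arcs Q) \<inter> R) + 2" by (simp add: card_insert_if)
    finally show "card (c ` set (vwalk_arcs ?N) \<inter> R) \<le> 2 * (length (Ps @ [P]) - 1)"
      using Q(7) snoc.hyps by (cases Ps) auto
    show "length (concat (Ps @ [P])) \<le> length ?N" using Q(8) Q'(5) by simp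
  qed
  then show ?case ..
qed

text \<open>One more link, from the end of the joined path back to its first vertex.\<close>
theorem exists_linked_cycle:
  assumes W: "W \<subseteq> V" and PV: "\<Union>(set ` set Ps) \<subseteq> V - W"
    and conn: "\<And>x x' y. x \<in> V \<Longrightarrow> x' \<in> V \<Longrightarrow> y \<in> V \<Longrightarrow> x \<noteq> x' \<Longrightarrow> x \<noteq> y \<Longrightarrow> x' \<noteq> y \<Longrightarrow>
      M \<le> card (connectors W R x y) \<or> M \<le> card (connectors W R x' y)"
    and few: "5 * length Ps \<le> M" and ne: "Ps \<noteq> []"
    and Ps: "distinct (concat Ps)" "\<And>P. P \<in> set Ps \<Longrightarrow> 3 \<le> length P"
    and inj: "inj_on c (\<Union>((\<lambda>P. set (vwalk_arcs P)) ` set Ps))"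
    and avoid: "c ` (\<Union>((\<lambda>P. set (vwalk_arcs P)) ` set Ps)) \<inter> R = {}"
  obtains C where "distinct C" "C \<noteq> []" "set C \<subseteq> V" "length (concat Ps) \<le> length C"
    "inj_on c (set (vwalk_arcs (C @ [hd C])))"
proof -
  obtain Q where Q: "distinct Q" "hd Q = hd (hd Ps)"
     "set Q \<subseteq> \<Union>(set ` set Ps) \<union> W" "card (set Q \<inter> W) < length Ps"
     "inj_on c (set (vwalk_arcs Q))"
     "card (c ` set (vwalk_arcs Q) \<inter> R) \<le> 2 * (length Ps - 1)"
     "length (concat Ps) \<le> length Q"
    using exists_linked_path[OF W PV conn few ne Ps inj avoid] unfolding linked_def by blast
  have "3 \<le> length (concat Ps)" using Ps(2)[of "hd Ps"] ne by (cases Ps) auto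
  then have Q3: "3 \<le> length Q" using Q(7) by linarith
  have QV: "set Q \<subseteq> V" using Q(3) PV W by blast
  have Qne: "Q \<noteq> []" using Q3 by auto
  have hdV: "hd Q \<in> V" using QV Qne by auto
  have hdQ: "hd Q \<notin> set (tl Q)" using Q(1) Qne by (cases Q) auto
  have few': "card (set Q \<inter> W) + 2 * card (c ` set (vwalk_arcs Q) \<inter> R) < M"
    using Q(4,6) few by simp
  obtain Q' w where Q': "Q' \<noteq> []" "hd Q' = hd Q" "set Q' \<subseteq> set Q" "distinct Q'"
    "length Q \<le> length Q' + 1" "set (vwalk_arcs Q') \<subseteq> set (vwalk_arcs Q)"
    and w: "w \<in> W" "w \<notin> set Q" "c (last Q', w) \<in> R" "c (w, hd Q) \<in> R"
      "c (last Q', w) \<noteq> c (w, hd Q)"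
      "c (last Q', w) \<notin> c ` set (vwalk_arcs Q)" "c (w, hd Q) \<notin> c ` set (vwalk_arcs Q)"
    by (rule exists_link[OF W Q(1) Q3 QV hdV hdQ conn few'])
      (use hdV in auto)
  let ?C = "Q' @ [w]"
  have arcs: "set (vwalk_arcs (?C @ [hd ?C])) =
      insert (last Q', w) (insert (w, hd Q) (set (vwalk_arcs Q')))"
    using Q'(1,2) by (auto simp: vwalk_arcs_append)
  show thesis
  proof (rule that[of ?C])
    show "distinct ?C" using Q'(3,4) w(2) by auto
    show "set ?C \<subseteq> V" using Q'(3) QV w(1) W by auto
    show "length (concat Ps) \<le> length ?C" using Q(7) Q'(5) by simp
    have "inj_on c (set (vwalk_arcs Q'))" using Q(5) Q'(6) by (rule inj_on_subset)
    moreover have "c (last Q', w) \<notin> c ` set (vwalk_arcs Q')" "c (w, hd Q) \<notin> c ` set (vwalk_arcs Q')"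
      using w(6,7) Q'(6) by blast+
    ultimately show "inj_on c (set (vwalk_arcs (?C @ [hd ?C])))"
      unfolding arcs using w(5) by auto
  qed simp
qed

end

section \<open>Translation to arcs of a complete digraph\<close>

text \<open>In a complete digraph an ordered pair of distinct vertices is joined by exactly one arc.\<close>
definition arc_of :: "('a, 'b) pre_digraph \<Rightarrow> 'a \<times> 'a \<Rightarrow> 'b" where
  "arc_of G e = (SOME a. a \<in> arcs G \<and> tail G a = fst e \<and> head G a = snd e)"

lemma arc_of:
  assumes "complete_digraph n G" "u \<in> verts G" "v \<in> verts G" "u \<noteq> v"
  shows "arc_of G (u, v) \<in> arcs G \<and> tail G (arc_of G (u, v)) = u \<and> head G (arc_of G (u, v)) = v"
proof -
  have "(u, v) \<in> arcs_ends G" using assms by (simp add: complete_digraph_def)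
  then have "\<exists>a. a \<in> arcs G \<and> tail G a = u \<and> head G a = v"
    by (auto simp: arcs_ends_def arc_to_ends_def)
  then show ?thesis unfolding arc_of_def fst_conv snd_conv by (rule someI_ex)
qed

lemma proper_colouring_of_complete:
  assumes "complete_digraph n G" "proper_arc_colouring G c"
  shows "proper_colouring (verts G) (c \<circ> arc_of G)"
proof
  interpret graph G using assms(1) by (simp add: complete_digraph_def)
  show "finite (verts G)" by simp
  note a = arc_of[OF assms(1)]
  show "inj_on (\<lambda>v. (c \<circ> arc_of G) (x, v)) (verts G - {x})" if "x \<in> verts G" for x
  proof (rule inj_onI)
    fix v w assume vw: "v \<in> verts G - {x}" "w \<in> verts G - {x}"
      "(c \<circ> arc_of G) (x, v) = (c \<circ> arc_of G) (x, w)"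
    have "arc_of G (x, v) \<in> arcs G \<and> tail G (arc_of G (x, v)) = x \<and> head G (arc_of G (x, v)) = v"
      "arc_of G (x, w) \<in> arcs G \<and> tail G (arc_of G (x, w)) = x \<and> head G (arc_of G (x, w)) = w"
      using a that vw by auto
    then show "v = w" using vw(3) assms(2) unfolding proper_arc_colouring_def o_apply by metis
  qed
  show "inj_on (\<lambda>v. (c \<circ> arc_of G) (v, x)) (verts G - {x})" if "x \<in> verts G" for x
  proof (rule inj_onI)
    fix v w assume vw: "v \<in> verts G - {x}" "w \<in> verts G - {x}"
      "(c \<circ> arc_of G) (v, x) = (c \<circ> arc_of G) (w, x)"
    have "arc_of G (v, x) \<in> arcs G \<and> tail G (arc_of G (v, x)) = v \<and> head G (arc_of G (v, x)) = x"
      "arc_of G (w, x) \<in> arcs G \<and> tail G (arc_of G (w, x)) = w \<and> head G (arc_of G (w, x)) = x"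
      using a that vw by auto
    then show "v = w" using vw(3) assms(2) unfolding proper_arc_colouring_def o_apply by metis
  qed
qed

lemma awalk_of_vertex_list:
  assumes "complete_digraph n G" "p \<noteq> []" "set p \<subseteq> verts G" "\<And>u v. (u, v) \<in> set (vwalk_arcs p) \<Longrightarrow> u \<noteq> v"
  shows "pre_digraph.awalk G (hd p) (map (arc_of G) (vwalk_arcs p)) (last p)"
    and "pre_digraph.awalk_verts G (hd p) (map (arc_of G) (vwalk_arcs p)) = p"
proof -
  interpret graph G using assms(1) by (simp add: complete_digraph_def)
  have "awalk (hd p) (map (arc_of G) (vwalk_arcs p)) (last p) \<and>
    awalk_verts (hd p) (map (arc_of G) (vwalk_arcs p)) = p"
    using assms(2-4)
  proof (induction p rule: vwalk_arcs.induct)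
    case (3 x y xs)
    have "arc_of G (x, y) \<in> arcs G \<and> tail G (arc_of G (x, y)) = x \<and> head G (arc_of G (x, y)) = y"
      using 3 by (intro arc_of[OF assms(1)]) auto
    moreover have "awalk (hd (y # xs)) (map (arc_of G) (vwalk_arcs (y # xs))) (last (y # xs)) \<and>
      awalk_verts (hd (y # xs)) (map (arc_of G) (vwalk_arcs (y # xs))) = y # xs"
      using 3 by (intro 3) auto
    ultimately show ?case using 3 by (simp add: awalk_Cons_iff)
  qed (auto simp: awalk_Nil_iff)
  then show "awalk (hd p) (map (arc_of G) (vwalk_arcs p)) (last p)"
    "awalk_verts (hd p) (map (arc_of G) (vwalk_arcs p)) = p" by auto
qed

lemma distinct_arcs_loopfree:
  "distinct p \<Longrightarrow> (u, v) \<in> set (vwalk_arcs p) \<Longrightarrow> u \<noteq> v"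
  by (induction p rule: vwalk_arcs.induct) auto

lemma path_forest_of_path_system:
  assumes G: "complete_digraph n G" and P: "path_system S P" and V: "(\<Union>s\<in>S. set (P s)) \<subseteq> verts G"
    and F: "(\<Union>s\<in>S. set (vwalk_arcs (P s))) = F" and inj: "inj_on (c \<circ> arc_of G) F"
  shows "\<exists>\<P>. path_forest G \<P> \<and> rainbow c (forest_arcs \<P>) \<and> forest_length \<P> = card F"
proof -
  let ?p = "\<lambda>s. map (arc_of G) (vwalk_arcs (P s))"
  let ?P = "(\<lambda>s. (s, ?p s)) ` S"
  have Ps: "P s \<noteq> []" "hd (P s) = s" "distinct (P s)" "set (P s) \<subseteq> verts G" if "s \<in> S" for s
    using P V that by (auto simp: path_system_def)
  have walk: "pre_digraph.awalk G s (?p s) (last (P s))" "pre_digraph.awalk_verts G s (?p s) = P s"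
    if "s \<in> S" for s
    using awalk_of_vertex_list[OF G Ps(1,4)[OF that] distinct_arcs_loopfree[OF Ps(3)[OF that]]] Ps(2)[OF that]
    by auto
  have "path_forest G ?P"
    unfolding path_forest_def
  proof (intro conjI)
    show "\<forall>(u, p)\<in>?P. \<exists>v. pre_digraph.apath G u p v"
      using walk Ps(3) by (auto simp: pre_digraph.apath_def)
    show "pairwise (\<lambda>(u, p) (w, q). disjnt (set (pre_digraph.awalk_verts G u p)) (set (pre_digraph.awalk_verts G w q))) ?P"
    proof (rule pairwiseI)
      fix a b assume "a \<in> ?P" "b \<in> ?P" "a \<noteq> b"
      then obtain s s' where s: "s \<in> S" "s' \<in> S" "a = (s, ?p s)" "b = (s', ?p s')" "s \<noteq> s'" by auto
      then have "set (P s) \<inter> set (P s') = {}" using P unfolding path_system_def by blast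
      then show "(\<lambda>(u, p) (w, q). disjnt (set (pre_digraph.awalk_verts G u p)) (set (pre_digraph.awalk_verts G w q))) a b"
        using walk(2)[OF s(1)] walk(2)[OF s(2)] unfolding s(3,4) prod.case by (simp add: disjnt_def)
    qed
  qed
  moreover have arcs: "forest_arcs ?P = arc_of G ` F"
    unfolding forest_arcs_def F[symmetric] by auto
  moreover have "rainbow c (arc_of G ` F)"
    using inj unfolding rainbow_def by (rule inj_on_imageI)
  moreover have "forest_length ?P = card F"
    unfolding forest_length_def arcs using inj by (intro card_image) (rule inj_on_imageI2)
  ultimately show ?thesis by (intro exI[of _ ?P]) simp
qed

lemma cycle_of_vertex_list:
  assumes G: "complete_digraph n G" and C: "distinct C" "2 \<le> length C" "set C \<subseteq> verts G"
    and inj: "inj_on (c \<circ> arc_of G) (set (vwalk_arcs (C @ [hd C])))"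
  shows "\<exists>p. pre_digraph.cycle G p \<and> rainbow c (set p) \<and> length p = length C"
proof -
  let ?C = "C @ [hd C]"
  let ?p = "map (arc_of G) (vwalk_arcs ?C)"
  have Cne: "C \<noteq> []" using C(2) by auto
  have "last C \<noteq> hd C"
    using C(1,2) by (cases C) (auto split: if_splits)
  then have loopfree: "u \<noteq> v" if "(u, v) \<in> set (vwalk_arcs ?C)" for u v
    using that distinct_arcs_loopfree[OF C(1)] Cne by (auto simp: set_vwalk_arcs_snoc)
  have VC: "set ?C \<subseteq> verts G" using C(3) Cne by auto
  have "pre_digraph.awalk G (hd ?C) ?p (last ?C)" "pre_digraph.awalk_verts G (hd ?C) ?p = ?C"
    using awalk_of_vertex_list[OF G _ VC loopfree] by auto
  moreover have "distinct (tl ?C)" using C(1) Cne by (cases C) auto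
  moreover have "hd ?C = last ?C" using Cne by simp
  moreover have len: "length ?p = length C"
    using vwalk_length_simp[of ?C, unfolded vwalk_length_def] by simp
  ultimately have "pre_digraph.cycle G ?p"
    unfolding pre_digraph.cycle_def using Cne by (metis length_0_conv)
  moreover have "rainbow c (set ?p)"
    using inj unfolding rainbow_def set_map by (rule inj_on_imageI)
  ultimately show ?thesis using len by blast
qed

section \<open>Rainbow forests and cycles for given parameters\<close>

text \<open>All arcs are admissible and the set of roots is arbitrary.\<close>
lemma rainbow_path_forest:
  fixes m r n :: nat
  assumes G: "complete_digraph n G" and c: "proper_arc_colouring G c"
    and mr: "0 < m" "m \<le> r" "r \<le> n"
  shows "\<exists>\<P>. path_forest G \<P> \<and> rainbow c (forest_arcs \<P>) \<and>
    real (forest_length \<P>) \<ge> real n - 1 - r - real m * n / r - n / real m"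
proof -
  interpret proper_colouring "verts G" "c \<circ> arc_of G" by (rule proper_colouring_of_complete[OF G c])
  have n: "card (verts G) = n" using G by (simp add: complete_digraph_def)
  have "r \<le> card (verts G)" using mr(3) n by simp
  then obtain S where S: "S \<subseteq> verts G" "card S = r" by (rule obtain_subset_with_card_n)
  let ?H = "{(u, v). u \<in> verts G \<and> v \<in> verts G \<and> u \<noteq> v}"
  have Hx: "?H `` {x} = verts G - {x}" if "x \<in> verts G" for x using that by auto
  obtain F where F: "rooted_forest S F" "F \<subseteq> ?H" "inj_on (c \<circ> arc_of G) F"
    "real (card F) \<ge> real (n - 1) - card S - real m * card (verts G) / card S - card (verts G) / real m"
  proof (rule long_rainbow_forest[of "verts G" ?H S "n - 1" "c \<circ> arc_of G" m])
    show "n - 1 \<le> card (?H `` {x})" if "x \<in> verts G" for x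
      unfolding Hx[OF that] using n that finV by simp
    show "inj_on (\<lambda>v. (c \<circ> arc_of G) (x, v)) (?H `` {x})" if "x \<in> verts G" for x
      unfolding Hx[OF that] using out_inj[OF that] .
  qed (use S mr finV in auto)
  obtain P where P: "path_system S P" "(\<Union>s\<in>S. set (vwalk_arcs (P s))) = F"
    "(\<Union>s\<in>S. set (P s)) = S \<union> Range F"
    by (rule rooted_forest_paths[OF F(1)])
  have PV: "(\<Union>s\<in>S. set (P s)) \<subseteq> verts G" unfolding P(3) using S(1) F(2) by auto
  obtain \<P> where "path_forest G \<P>" "rainbow c (forest_arcs \<P>)" "forest_length \<P> = card F"
    using path_forest_of_path_system[OF G P(1) PV P(2) F(3)] by blast
  then show ?thesis using F(4) S(2) n mr by (intro exI[of _ \<P>]) (simp add: of_nat_diff)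
qed

context proper_colouring begin

text \<open>
  Set aside the reservoir, take a long forest with \<open>r\<close> roots that avoids it, and link its paths
  into a cycle. The reservoir costs \<open>K\<close> vertices and \<open>K\<close> further out-neighbours at each vertex.
  Paths with fewer than three vertices are too short for \<open>exists_link\<close>; dropping them costs
  at most \<open>2 * r\<close> vertices.
\<close>
lemma long_rainbow_cycle:
  fixes m r M K :: nat and p :: real
  assumes p: "0 \<le> p" "p \<le> 1"
    and small: "real (card V ^ 2) * (2 ^ M * (1 - p ^ 3 / 2) ^ ((card V - 3) div 6)) +
      real (card V + 1) * ((1 + p) ^ card V / 2 ^ K) < 1"
    and mr: "0 < m" "m \<le> r" "5 * r \<le> M"
    and pos: "real (card V) - 1 - 2 * K - 2 * r - real m * card V / r - card V / real m > 0"
  obtains C where "distinct C" "C \<noteq> []" "set C \<subseteq> V" "inj_on c (set (vwalk_arcs (C @ [hd C])))"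
    "real (length C) \<ge> real (card V) - 1 - 2 * K - 2 * r - real m * card V / r - card V / real m"
proof -
  obtain W R where W: "W \<subseteq> V" "card W \<le> K"
    and R: "\<And>x. x \<in> V \<Longrightarrow> card {v \<in> V - {x}. c (x, v) \<in> R} \<le> K"
    and conn: "\<And>x x' y. x \<in> V \<Longrightarrow> x' \<in> V \<Longrightarrow> y \<in> V \<Longrightarrow> x \<noteq> x' \<Longrightarrow> x \<noteq> y \<Longrightarrow> x' \<noteq> y \<Longrightarrow>
      M \<le> card (connectors W R x y) \<or> M \<le> card (connectors W R x' y)"
    by (rule exists_reservoir[OF p small]) blast
  have finW: "finite W" using W(1) finV finite_subset by blast
  let ?V = "V - W"
  have cV: "card ?V = card V - card W" "card W \<le> card V"
    using W(1) finV finW by (auto simp: card_Diff_subset card_mono)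
  have nonneg: "0 \<le> real m * card V / r" "0 \<le> card V / real m" by auto
  have "real (card V) > 1 + 2 * K + 2 * r" using pos nonneg by linarith
  then have big: "1 + 2 * K + 2 * r < card V" by (metis of_nat_1 of_nat_add of_nat_less_iff of_nat_mult of_nat_numeral)
  then have "r \<le> card ?V" using cV W(2) by linarith
  then obtain S where S: "S \<subseteq> ?V" "card S = r" by (rule obtain_subset_with_card_n)
  let ?H = "{(u, v). u \<in> ?V \<and> v \<in> ?V \<and> u \<noteq> v \<and> c (u, v) \<notin> R}"
  obtain F where F: "rooted_forest S F" "F \<subseteq> ?H" "inj_on c F"
    "real (card F) \<ge> real (card V - 1 - 2 * K) - card S - real m * card ?V / card S - card ?V / real m"
  proof (rule long_rainbow_forest[of ?V ?H S "card V - 1 - 2 * K" c m])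
    show "card V - 1 - 2 * K \<le> card (?H `` {x})" if x: "x \<in> ?V" for x
    proof -
      let ?B = "{v \<in> V - {x}. c (x, v) \<in> R}"
      have "?H `` {x} = V - (insert x W \<union> ?B)" using x by auto
      moreover have "card V - card (insert x W \<union> ?B) \<le> card (V - (insert x W \<union> ?B))"
        using finV finW by (intro diff_card_le_card_Diff) auto
      moreover have "card (insert x W \<union> ?B) \<le> (K + 1) + K"
      proof (rule order.trans[OF card_Un_le add_mono])
        show "card (insert x W) \<le> K + 1" using W(2) finW by (simp add: card_insert_if)
        show "card ?B \<le> K" using R x by blast
      qed
      ultimately show ?thesis by simp
    qed
    show "inj_on (\<lambda>v. c (x, v)) (?H `` {x})" if "x \<in> ?V" for x
      using that by (intro inj_on_subset[OF out_inj[of x]]) auto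
  qed (use S mr finV in auto)
  have finS: "finite S" using S(1) finV by (meson finite_Diff finite_subset)
  have "card ?V \<le> card V" using cV by simp
  then have "real m * card ?V / r \<le> real m * card V / r" "card ?V / real m \<le> card V / real m"
    by (intro divide_right_mono mult_left_mono; simp)+
  then have Flen: "real (card F) \<ge> real (card V) - 1 - 2 * K - r - real m * card V / r - card V / real m"
    using F(4) S(2) big by (simp add: of_nat_diff)
  obtain P where P: "path_system S P" "(\<Union>s\<in>S. set (vwalk_arcs (P s))) = F"
    "(\<Union>s\<in>S. set (P s)) = S \<union> Range F"
    by (rule rooted_forest_paths[OF F(1)])
  have Pd: "distinct (P s)" if "s \<in> S" for s using P(1) that by (simp add: path_system_def)
  have disj: "set (P s) \<inter> set (P s') = {}" if "s \<in> S" "s' \<in> S" "s \<noteq> s'" for s s'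
    using P(1) that unfolding path_system_def by blast
  define T where "T = {s \<in> S. 3 \<le> length (P s)}"
  have TS: "T \<subseteq> S" "finite T" using finS by (auto simp: T_def)
  obtain ss where ss: "set ss = T" "distinct ss" using finite_distinct_list[OF TS(2)] by blast
  let ?Ps = "map P ss"
  have dist: "distinct (concat ?Ps)"
    using ss(2) TS(1) Pd disj unfolding ss(1)[symmetric]
    by (induction ss) fastforce+
  have total: "card F + card S \<le> length (concat ?Ps) + 2 * card S"
  proof -
    have lin: "linear_digraph F" and SR: "S \<inter> Range F = {}" using F(1) by (auto simp: rooted_forest_def)
    then have "card F + card S = card (S \<union> Range F)"
      using finS linear_card_Range[OF lin]
      by (subst card_Un_disjoint) (auto simp: linear_digraph_def finite_Range)
    also have "\<dots> = (\<Sum>s\<in>S. card (set (P s)))"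
      unfolding P(3)[symmetric] using finS disj by (intro card_UN_disjoint) auto
    also have "\<dots> = (\<Sum>s\<in>S. length (P s))"
      using Pd by (intro sum.cong refl distinct_card) auto
    also have "\<dots> = (\<Sum>s\<in>T. length (P s)) + (\<Sum>s\<in>S - T. length (P s))"
      using finS TS(1) by (metis add.commute sum.subset_diff)
    also have "(\<Sum>s\<in>S - T. length (P s)) \<le> (\<Sum>s\<in>S - T. 2)"
      by (intro sum_mono) (auto simp: T_def)
    also have "\<dots> \<le> 2 * card S" using finS by (simp add: card_mono)
    also have "(\<Sum>s\<in>T. length (P s)) = length (concat ?Ps)"
      using ss by (simp add: length_concat sum_list_distinct_conv_sum_set comp_def)
    finally show ?thesis by simp
  qed
  have arcsF: "\<Union>((\<lambda>P. set (vwalk_arcs P)) ` set ?Ps) \<subseteq> F"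
    using ss(1) TS(1) unfolding P(2)[symmetric] by auto
  have PsV: "\<Union>(set ` set ?Ps) \<subseteq> ?V"
  proof -
    have "\<Union>(set ` set ?Ps) \<subseteq> (\<Union>s\<in>S. set (P s))" using ss(1) TS(1) by auto
    then show ?thesis using P(3) S(1) F(2) by auto
  qed
  have lenconcat: "real (card F) - r \<le> length (concat ?Ps)" using total S(2) by linarith
  have ne: "?Ps \<noteq> []"
  proof
    assume "?Ps = []"
    then have "length (concat ?Ps) = 0" by simp
    then show False using lenconcat Flen pos by linarith
  qed
  have "length ?Ps = card T" using ss distinct_card[of ss] by simp
  also have "\<dots> \<le> r" using TS finS S(2) by (metis card_mono)
  finally have few: "5 * length ?Ps \<le> M" using mr(3) by linarith
  have long: "3 \<le> length p" if "p \<in> set ?Ps" for p using that ss(1) by (auto simp: T_def)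
  have inj: "inj_on c (\<Union>((\<lambda>P. set (vwalk_arcs P)) ` set ?Ps))"
    using F(3) arcsF by (rule inj_on_subset)
  have avoid: "c ` (\<Union>((\<lambda>P. set (vwalk_arcs P)) ` set ?Ps)) \<inter> R = {}"
    using arcsF F(2) by fastforce
  obtain C where C: "distinct C" "C \<noteq> []" "set C \<subseteq> V" "length (concat ?Ps) \<le> length C"
    "inj_on c (set (vwalk_arcs (C @ [hd C])))"
    by (rule exists_linked_cycle[OF W(1) PsV conn few ne dist long inj avoid])
  have "real (card F) - r \<le> length C" using lenconcat C(4) by linarith
  then have "real (length C) \<ge> real (card V) - 1 - 2 * K - 2 * r - real m * card V / r - card V / real m"
    using Flen by linarith
  then show thesis using that C by blast
qed

end

section \<open>Choice of the parameters\<close>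

text \<open>
  With \<open>x = n powr (1/5)\<close> and \<open>p = 1 / x\<close>, a pair has about \<open>p ^ 3 * n = x ^ 2\<close> connectors up to
  a constant factor, and \<open>p * n = x ^ 4\<close> is the expected number of reserved vertices.
\<close>
lemma reservoir_bound:
  fixes x :: real and n M K :: nat
  assumes n: "real n = x ^ 5" and x: "3 \<le> x" and M: "M \<le> x ^ 2 / 28" and K: "4 * x ^ 4 \<le> K"
    and small: "x ^ 10 * exp (- (x ^ 2 / 28)) + (x ^ 5 + 1) * exp (- (x ^ 4)) < 1"
  shows "real (n ^ 2) * (2 ^ M * (1 - (1 / x) ^ 3 / 2) ^ ((n - 3) div 6)) +
      real (n + 1) * ((1 + 1 / x) ^ n / 2 ^ K) < 1"
proof -
  have x0: "0 < x" using x by simp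
  have ln2: "1 / 2 \<le> ln (2::real)" "ln (2::real) \<le> 1"
    using iffD2[OF ln_ge_iff[of "2::real" "1 / 2"]] ln_le_minus_one[of "2::real"] exp_half_le2 by simp_all
  have "3 ^ 5 \<le> x ^ 5" using x by (intro power_mono) auto
  then have n243: "243 \<le> n" using n by simp
  then have "n \<le> 7 * ((n - 3) div 6)" by presburger
  then have N: "real n / 7 \<le> real ((n - 3) div 6)" by linarith
  have "1 - (1 / x) ^ 3 / 2 \<le> exp (- ((1 / x) ^ 3 / 2))"
    using exp_ge_add_one_self[of "- ((1 / x) ^ 3 / 2)"] by simp
  moreover have "0 \<le> 1 - (1 / x) ^ 3 / 2"
    using power_le_one[of "1 / x" 3] x by simp
  ultimately have "(1 - (1 / x) ^ 3 / 2) ^ ((n - 3) div 6) \<le> exp (- ((1 / x) ^ 3 / 2)) ^ ((n - 3) div 6)"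
    by (intro power_mono) auto
  also have "\<dots> = exp (- (real ((n - 3) div 6) * ((1 / x) ^ 3 / 2)))"
    by (simp add: exp_of_nat_mult[symmetric])
  also have "\<dots> \<le> exp (- (x ^ 2 / 14))"
  proof -
    have "x ^ 2 / 14 = real n / 7 * ((1 / x) ^ 3 / 2)"
      using x0 unfolding n by (simp add: field_simps power_numeral_reduce)
    also have "\<dots> \<le> real ((n - 3) div 6) * ((1 / x) ^ 3 / 2)"
      using N x0 by (intro mult_right_mono) auto
    finally show ?thesis by simp
  qed
  finally have lower: "(1 - (1 / x) ^ 3 / 2) ^ ((n - 3) div 6) \<le> exp (- (x ^ 2 / 14))" .
  have "(2::real) ^ M = exp (M * ln 2)" by (simp add: exp_of_nat_mult)
  also have "\<dots> \<le> exp (x ^ 2 / 28)"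
  proof -
    have "M * ln 2 \<le> M * (1::real)" using ln2 by (intro mult_left_mono) auto
    then show ?thesis using M by simp
  qed
  finally have "2 ^ M * (1 - (1 / x) ^ 3 / 2) ^ ((n - 3) div 6) \<le> exp (x ^ 2 / 28) * exp (- (x ^ 2 / 14))"
    using lower \<open>0 \<le> 1 - (1 / x) ^ 3 / 2\<close> by (intro mult_mono) auto
  also have "\<dots> = exp (- (x ^ 2 / 28))" by (simp add: exp_add[symmetric])
  finally have 1: "2 ^ M * (1 - (1 / x) ^ 3 / 2) ^ ((n - 3) div 6) \<le> exp (- (x ^ 2 / 28))" .
  have "(1 + 1 / x) ^ n \<le> exp (1 / x) ^ n"
    using exp_ge_add_one_self[of "1 / x"] x0 by (intro power_mono) auto
  also have "\<dots> = exp (x ^ 4)"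
    using x0 by (simp add: exp_of_nat_mult[symmetric] n power_numeral_reduce)
  finally have up: "(1 + 1 / x) ^ n \<le> exp (x ^ 4)" .
  have "2 * x ^ 4 \<le> K * ln 2"
  proof -
    have "4 * x ^ 4 * (1 / 2) \<le> K * ln 2" using K ln2 x0 by (intro mult_mono) auto
    then show ?thesis by simp
  qed
  moreover have "(2::real) ^ K = exp (K * ln 2)" by (simp add: exp_of_nat_mult)
  ultimately have "exp (2 * x ^ 4) \<le> 2 ^ K" by simp
  then have "(1 + 1 / x) ^ n / 2 ^ K \<le> exp (x ^ 4) / exp (2 * x ^ 4)"
    using up by (intro frac_le) auto
  also have "\<dots> = exp (- (x ^ 4))" by (simp add: exp_diff[symmetric])
  finally have 2: "(1 + 1 / x) ^ n / 2 ^ K \<le> exp (- (x ^ 4))" .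
  have sizes: "real (n ^ 2) = x ^ 10" "real (n + 1) = x ^ 5 + 1"
    unfolding of_nat_power of_nat_add n by (simp_all add: power_mult[symmetric])
  have "real (n ^ 2) * (2 ^ M * (1 - (1 / x) ^ 3 / 2) ^ ((n - 3) div 6)) +
      real (n + 1) * ((1 + 1 / x) ^ n / 2 ^ K) \<le> x ^ 10 * exp (- (x ^ 2 / 28)) + (x ^ 5 + 1) * exp (- (x ^ 4))"
    unfolding sizes using x0 by (intro add_mono mult_left_mono 1 2) auto
  then show ?thesis using small by linarith
qed

text \<open>
  The choice \<open>m = n powr (1/3)\<close> and \<open>r = n powr (2/3)\<close>, up to rounding, makes \<open>r\<close>,
  \<open>m * n / r\<close> and \<open>n / m\<close> equal.
\<close>
lemma path_forest_bound:
  fixes n :: nat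
  assumes "1 \<le> n"
  defines "y \<equiv> real n powr (1 / 3)"
  shows "\<exists>m r. 0 < m \<and> m \<le> r \<and> r \<le> n \<and>
    1 + real r + real m * n / r + n / real m \<le> 6 * real n powr (2 / 3)"
proof -
  have y1: "1 \<le> y" using assms(1) by (simp add: y_def ge_one_powr_ge_zero)
  have y3: "real n = y ^ 3" and y2: "real n powr (2 / 3) = y ^ 2"
    using assms(1) by (simp_all add: y_def powr_power)
  define m r where "m = nat \<lceil>y\<rceil>" and "r = nat \<lceil>y ^ 2\<rceil>"
  have "y \<le> y ^ 2" "y ^ 2 \<le> y ^ 3" "1 \<le> y ^ 2"
    using y1 power_increasing[of 1 2 y] power_increasing[of 2 3 y] by auto
  have m: "y \<le> m" "m \<le> 2 * y" and r: "y ^ 2 \<le> r" "r \<le> y ^ 2 + 1"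
    unfolding m_def r_def using y1 \<open>1 \<le> y ^ 2\<close> by linarith+
  have "m \<le> r" unfolding m_def r_def using \<open>y \<le> y ^ 2\<close> by (intro nat_mono ceiling_mono)
  moreover have "r \<le> n"
    unfolding r_def using \<open>y ^ 2 \<le> y ^ 3\<close> y3 by (simp add: nat_le_iff ceiling_le_iff)
  moreover have "0 < m" using m(1) y1 by linarith
  moreover have "real m * n / r \<le> (2 * y) * y ^ 3 / y ^ 2"
    unfolding y3 using m r y1 \<open>1 \<le> y ^ 2\<close> by (intro frac_le mult_mono) auto
  moreover have "(2 * y) * y ^ 3 / y ^ 2 = 2 * y ^ 2"
    using y1 by (simp add: field_simps power_numeral_reduce)
  moreover have "n / real m \<le> y ^ 3 / y"
    unfolding y3 using m y1 by (intro frac_le) auto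
  moreover have "y ^ 3 / y = y ^ 2" using y1 by (simp add: power_numeral_reduce)
  ultimately show ?thesis
    using r(2) \<open>1 \<le> y ^ 2\<close> unfolding y2 by (intro exI[of _ m] exI[of _ r]) linarith
qed

theorem theorem1p1:
  shows "\<exists>C > (0::real). \<exists>n\<^sub>0 :: nat. \<forall>n \<ge> n\<^sub>0.
    \<forall>(G :: ('a, 'b) pre_digraph) (c :: 'b \<Rightarrow> 'c).
      complete_digraph n G \<and> proper_arc_colouring G c \<longrightarrow>
        (\<exists>F. path_forest G F \<and> rainbow c (forest_arcs F) \<and>
             real (forest_length F) \<ge> real n - C * real n powr (2 / 3)) \<and>
        (\<exists>p. pre_digraph.cycle G p \<and> rainbow c (set p) \<and>
             real (length p) \<ge> real n - C * real n powr (4 / 5))"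
proof -
  have "eventually (\<lambda>x::real. x ^ 10 * exp (- (x ^ 2 / 28)) + (x ^ 5 + 1) * exp (- (x ^ 4)) < 1) at_top"
    by real_asymp
  then obtain x0 :: real where x0: "\<And>x. x0 \<le> x \<Longrightarrow> x ^ 10 * exp (- (x ^ 2 / 28)) + (x ^ 5 + 1) * exp (- (x ^ 4)) < 1"
    unfolding eventually_at_top_linorder by blast
  \<comment> \<open>The total loss for the cycle is at most \<open>1000 * x ^ 4\<close>, which is less than \<open>n = x ^ 5\<close> for
    \<open>x \<ge> 2000\<close>; larger \<open>x\<close> are required for the reservoir only.\<close>
  define x1 where "x1 = max x0 2000"
  define n0 where "n0 = nat \<lceil>x1 ^ 5\<rceil>"
  show ?thesis
  proof (intro exI[of _ "1000::real"] exI[of _ n0] conjI allI impI)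
    fix n and G :: "('a, 'b) pre_digraph" and c :: "'b \<Rightarrow> 'c"
    assume n0: "n0 \<le> n" and "complete_digraph n G \<and> proper_arc_colouring G c"
    then have G: "complete_digraph n G" and c: "proper_arc_colouring G c" by auto
    have "x1 ^ 5 \<le> n" using n0 unfolding n0_def by linarith
    have "0 < x1 ^ 5" by (simp add: x1_def)
    then have n1: "1 \<le> n" using \<open>x1 ^ 5 \<le> n\<close> by linarith
    define x where "x = real n powr (1 / 5)"
    have x5: "real n = x ^ 5" and x4: "real n powr (4 / 5) = x ^ 4"
      using n1 by (simp_all add: x_def powr_power)
    have "0 \<le> x" by (simp add: x_def)
    then have "x1 \<le> x"
      using \<open>x1 ^ 5 \<le> n\<close> power_mono_iff[of x1 x 5] unfolding x5 by (simp add: x1_def)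
    then have x: "2000 \<le> x" "x0 \<le> x" by (auto simp: x1_def)
    obtain m r where mr: "0 < m" "m \<le> r" "r \<le> n"
      and loss: "1 + real r + real m * n / r + n / real m \<le> 6 * real n powr (2 / 3)"
      using path_forest_bound[OF n1] by blast
    obtain F where F: "path_forest G F" "rainbow c (forest_arcs F)"
      "real (forest_length F) \<ge> real n - 1 - r - real m * n / r - n / real m"
      using rainbow_path_forest[OF G c mr] by blast
    have "0 \<le> real n powr (2 / 3)" by simp
    then have "real (forest_length F) \<ge> real n - 1000 * real n powr (2 / 3)"
      using F(3) loss by linarith
    then show "\<exists>F. path_forest G F \<and> rainbow c (forest_arcs F) \<and>
        real (forest_length F) \<ge> real n - 1000 * real n powr (2 / 3)"
      using F(1,2) by blast
    interpret proper_colouring "verts G" "c \<circ> arc_of G" by (rule proper_colouring_of_complete[OF G c])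
    have nV: "card (verts G) = n" using G by (simp add: complete_digraph_def)
    \<comment> \<open>\<open>M\<close> and \<open>K\<close> are as in \<open>reservoir_bound\<close>; \<open>r\<close> is small enough for \<open>5 * r \<le> M\<close>, and both
      \<open>m * n / r\<close> and \<open>n / m\<close> are of order \<open>x ^ 4\<close>.\<close>
    define M K m r where "M = nat \<lfloor>x ^ 2 / 28\<rfloor>" and "K = nat \<lceil>4 * x ^ 4\<rceil>"
      and "m = nat \<lceil>x\<rceil>" and "r = nat \<lfloor>x ^ 2 / 200\<rfloor>"
    have xx: "2000 * x \<le> x ^ 2" using x by (simp add: power2_eq_square)
    have x44: "x ^ 2 \<le> x ^ 4" "1 \<le> x ^ 4" using x by (auto intro: power_increasing)
    have M: "M \<le> x ^ 2 / 28" "x ^ 2 / 28 - 1 \<le> M" unfolding M_def using x xx by linarith+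
    have K: "4 * x ^ 4 \<le> K" "K \<le> 4 * x ^ 4 + 1" unfolding K_def using x44 by linarith+
    have m: "x \<le> m" "m \<le> 2 * x" unfolding m_def using x by linarith+
    have r: "r \<le> x ^ 2 / 200" "x ^ 2 / 400 \<le> r" unfolding r_def using x xx by linarith+
    have mr: "0 < m" "m \<le> r" "5 * r \<le> M" using m r M x xx by linarith+
    have "real m * n / r \<le> (2 * x) * x ^ 5 / (x ^ 2 / 400)"
      unfolding x5 using m r x by (intro frac_le mult_mono) auto
    also have "\<dots> = 800 * x ^ 4" using x by (simp add: field_simps power_numeral_reduce)
    finally have l1: "real m * n / r \<le> 800 * x ^ 4" .
    have "n / real m \<le> x ^ 5 / x" unfolding x5 using m x by (intro frac_le) auto
    also have "\<dots> = x ^ 4" using x by (simp add: power_numeral_reduce)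
    finally have l2: "n / real m \<le> x ^ 4" .
    have loss: "real n - 1000 * x ^ 4 \<le> real n - 1 - 2 * K - 2 * r - real m * n / r - n / real m"
      using l1 l2 K r x44 by linarith
    have "1000 * x ^ 4 < x * x ^ 4" using x by (intro mult_strict_right_mono) auto
    also have "\<dots> = real n" unfolding x5 by (simp add: power_numeral_reduce)
    finally have pos: "0 < real n - 1 - 2 * K - 2 * r - real m * n / r - n / real m"
      using loss by linarith
    have p: "0 \<le> 1 / x" "1 / x \<le> 1" using x by auto
    have small: "real (n ^ 2) * (2 ^ M * (1 - (1 / x) ^ 3 / 2) ^ ((n - 3) div 6)) +
        real (n + 1) * ((1 + 1 / x) ^ n / 2 ^ K) < 1"
      using x by (intro reservoir_bound[OF x5 _ M(1) K(1)] x0) auto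
    obtain C where C: "distinct C" "C \<noteq> []" "set C \<subseteq> verts G"
      "inj_on (c \<circ> arc_of G) (set (vwalk_arcs (C @ [hd C])))"
      "real (length C) \<ge> real n - 1 - 2 * K - 2 * r - real m * n / r - n / real m"
      by (rule long_rainbow_cycle[OF p, unfolded nV, OF small mr pos])
    have "2 \<le> length C"
    proof -
      have "1000 \<le> (x - 1000) * x ^ 4" using x x44 mult_mono[of 1000 "x - 1000" 1 "x ^ 4"] by simp
      also have "\<dots> = real n - 1000 * x ^ 4" unfolding x5 by (simp add: algebra_simps power_numeral_reduce)
      finally show ?thesis using loss C(5) by linarith
    qed
    then obtain p where "pre_digraph.cycle G p" "rainbow c (set p)" "length p = length C"
      using cycle_of_vertex_list[OF G C(1) _ C(3,4)] by blast
    then show "\<exists>p. pre_digraph.cycle G p \<and> rainbow c (set p) \<and>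
        real (length p) \<ge> real n - 1000 * real n powr (4 / 5)"
      using C(5) loss unfolding x4 by (intro exI[of _ p]) auto
  qed simp
qed

end
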